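(* Let $A_1,\ldots,A_6\in\mathbb{P}^2$ be the vertices of a hexagon $\mathcal{H}$ in the complex projective plane, and let $\mathcal{A}=\mathcal{A}(A_1,\ldots,A_6): f=0$ be the associated hexagonal line arrangement. Assume that $A_1,\ldots,A_6$ are situated on a conic which is either smooth or a union of two distinct lines, and that $\mathcal{A}$ consists of 9 distinct lines and has only double points except for 6 triple points, situated at $A_1,\ldots,A_6$. Then $\mathrm{mdr}(f)=5$ and $\mathcal{A}$ is not 2-formal.
   Context: $S=\mathbb{C}[x,y,z]$ with its standard grading; $S_k$ is the space of homogeneous polynomials of degree $k$. Hexagonal arrangement: given points $A_1,\ldots,A_6\in\mathbb{P}^2=\mathbb{P}^2(\mathbb{C})$, with $A_7=A_1$, the sides of the hexagon $\mathcal{H}$ are the lines $L_j:\ell_j=0$ determined by $A_j$ and $A_{j+1}$, $j=1,\ldots,6$, and the diagonals are the lines $L_k':\ell_k'=0$ determined by $A_k$ and $A_{k+3}$, $k=1,2,3$; here $\ell_j,\ell_k'\in S_1$ are linear forms. Set $\mathcal{A}(A_1,\ldots,A_6)=L_1\cup\cdots\cup L_6\cup L_1'\cup L_2'\cup L_3'$, with defining equation $f=\ell_1\cdots\ell_6\,\ell_1'\ell_2'\ell_3'=0$ of degree 9. A double (resp. triple) point of the arrangement is a point lying on exactly two (resp. three) of its lines. Minimal degree of a Jacobian relation: $D_0(f)=\{(a,b,c)\in S^3: af_x+bf_y+cf_z=0\}$ is the graded $S$-module of Jacobian syzygies of $f$, where a syzygy has degree $k$ if $a,b,c\in S_k$;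 $\mathrm{mdr}(f)$ is the smallest degree of a nonzero homogeneous element of $D_0(f)$. 2-formality: for an arrangement of $d$ distinct lines with equations given by linear forms $m_1,\ldots,m_d\in S_1$, the relation space $F(\mathcal{A})$ is the kernel of the linear map $\mathbb{C}^d\to S_1$, $e_j\mapsto m_j$, where $e_1,\ldots,e_d$ is the canonical basis of $\mathbb{C}^d$. The arrangement is 2-formal if $F(\mathcal{A})$ is spanned by relations involving only 3 lines of $\mathcal{A}$ (i.e. by vectors of $F(\mathcal{A})$ with exactly three nonzero coordinates). *)

theory Defs
  imports "HOL-Analysis.Analysis" "HOL-Library.Poly_Mapping"
begin

section \<open>The polynomial ring in three variables\<close>

text \<open>
  Polynomials are finitely supported maps from exponent vectors to coefficients, with the
  ring structure of \<^theory>\<open>HOL-Library.Poly_Mapping\<close>. The variables \<open>x, y, z\<close> and the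
  homogeneous coordinates are indexed by \<open>1, 2, 3\<close> of the three-element type \<open>3\<close>, in which
  \<open>3 = 0\<close>.
\<close>

type_synonym poly3 = "(3 \<Rightarrow>\<^sub>0 nat) \<Rightarrow>\<^sub>0 complex"

definition const3 :: "complex \<Rightarrow> poly3" where
  "const3 c = Poly_Mapping.single 0 c"

definition homogeneous :: "nat \<Rightarrow> poly3 set" where
  "homogeneous k = {p. \<forall>e \<in> Poly_Mapping.keys p. (\<Sum>i\<in>UNIV. Poly_Mapping.lookup e i) = k}"

definition eval3 :: "poly3 \<Rightarrow> complex^3 \<Rightarrow> complex" where
  "eval3 p v = (\<Sum>e\<in>Poly_Mapping.keys p.
     Poly_Mapping.lookup p e * (\<Prod>i\<in>UNIV. (v $ i) ^ Poly_Mapping.lookup e i))"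

text \<open>The truncated subtraction of exponents is harmless: a monomial not involving the
  \<open>i\<close>-th variable gets coefficient \<open>0\<close>.\<close>

definition pderiv3 :: "3 \<Rightarrow> poly3 \<Rightarrow> poly3" where
  "pderiv3 i p = (\<Sum>e\<in>Poly_Mapping.keys p.
     Poly_Mapping.single (e - Poly_Mapping.single i 1)
       (of_nat (Poly_Mapping.lookup e i) * Poly_Mapping.lookup p e))"

section \<open>Jacobian syzygies\<close>

definition jacobian_syzygies :: "poly3 \<Rightarrow> (poly3 \<times> poly3 \<times> poly3) set" where
  "jacobian_syzygies f =
     {(a, b, c). a * pderiv3 1 f + b * pderiv3 2 f + c * pderiv3 3 f = 0}"

text \<open>The set of degrees is never empty: if not all partial derivatives of \<open>f\<close> vanish, it
  contains the degrees of the Koszul syzygies (for homogeneous \<open>f\<close>), and otherwise \<open>0\<close>.\<close>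

definition mdr :: "poly3 \<Rightarrow> nat" where
  "mdr f = (LEAST k. \<exists>a \<in> homogeneous k. \<exists>b \<in> homogeneous k. \<exists>c \<in> homogeneous k.
     (a, b, c) \<noteq> (0, 0, 0) \<and> (a, b, c) \<in> jacobian_syzygies f)"

section \<open>The projective plane, lines and conics\<close>

text \<open>A point of the complex projective plane is a one-dimensional subspace of \<open>\<complex>\<^sup>3\<close>.\<close>

type_synonym ppoint = "(complex^3) set"

definition proj_plane :: "ppoint set" where
  "proj_plane = {vec.span {v} | v. v \<noteq> 0}"

definition zero_locus :: "poly3 \<Rightarrow> ppoint set" where
  "zero_locus p = {P \<in> proj_plane. \<forall>v\<in>P. eval3 p v = 0}"

definition line_equation :: "poly3 \<Rightarrow> ppoint \<Rightarrow> ppoint \<Rightarrow> bool" where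
  "line_equation l P Q \<longleftrightarrow>
     l \<in> homogeneous 1 \<and> l \<noteq> 0 \<and> P \<noteq> Q \<and> P \<in> zero_locus l \<and> Q \<in> zero_locus l"

definition smooth_conic :: "poly3 \<Rightarrow> bool" where
  "smooth_conic q \<longleftrightarrow> q \<in> homogeneous 2 \<and> q \<noteq> 0 \<and>
     (\<forall>P \<in> zero_locus q. \<forall>v\<in>P. v \<noteq> 0 \<longrightarrow> (\<exists>i. eval3 (pderiv3 i q) v \<noteq> 0))"

definition two_lines_conic :: "poly3 \<Rightarrow> bool" where
  "two_lines_conic q \<longleftrightarrow>
     (\<exists>l1 \<in> homogeneous 1. \<exists>l2 \<in> homogeneous 1. l1 \<noteq> 0 \<and> l2 \<noteq> 0 \<and>
        zero_locus l1 \<noteq> zero_locus l2 \<and> q = l1 * l2)"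

section \<open>Line arrangements\<close>

text \<open>An arrangement is given by a family \<open>m\<close> of linear forms with a finite index type.\<close>

definition arr_lines :: "('d \<Rightarrow> poly3) \<Rightarrow> ppoint set set" where
  "arr_lines m = {zero_locus (m j) | j. True}"

definition point_mult :: "('d::finite \<Rightarrow> poly3) \<Rightarrow> ppoint \<Rightarrow> nat" where
  "point_mult m P = card {L \<in> arr_lines m. P \<in> L}"

definition arr_poly :: "('d::finite \<Rightarrow> poly3) \<Rightarrow> poly3" where
  "arr_poly m = (\<Prod>j\<in>UNIV. m j)"

definition relation_space :: "('d::finite \<Rightarrow> poly3) \<Rightarrow> (complex^'d) set" where
  "relation_space m = {c. (\<Sum>j\<in>UNIV. const3 (c $ j) * m j) = 0}"

definition two_formal :: "('d::finite \<Rightarrow> poly3) \<Rightarrow> bool" where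
  "two_formal m \<longleftrightarrow>
     relation_space m = vec.span {c \<in> relation_space m. card {j. c $ j \<noteq> 0} = 3}"

text \<open>
  The vertices are indexed by the six-element type \<open>6\<close>, whose arithmetic is modulo \<open>6\<close>, so that
  \<open>A 7 = A 1\<close>. \<open>Inl j\<close> indexes the sides, \<open>Inr k\<close> the diagonals.
\<close>

definition hexagonal_arrangement :: "(6 \<Rightarrow> ppoint) \<Rightarrow> (6 + 3 \<Rightarrow> poly3) \<Rightarrow> bool" where
  "hexagonal_arrangement A m \<longleftrightarrow>
     (\<forall>j. line_equation (m (Inl j)) (A j) (A (j + 1))) \<and>
     line_equation (m (Inr 1)) (A 1) (A 4) \<and>
     line_equation (m (Inr 2)) (A 2) (A 5) \<and>
     line_equation (m (Inr 3)) (A 3) (A 6)"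

end

theory Submission
  imports Defs "HOL-Computational_Algebra.Polynomial"
begin

text \<open>
  Each side of the hexagon joins an odd vertex to an even one, and so does each of the three
  diagonals; together they are all nine lines joining \<open>A\<^sub>1, A\<^sub>3, A\<^sub>5\<close> to \<open>A\<^sub>2, A\<^sub>4, A\<^sub>6\<close>. So the
  arrangement is a projective drawing of the bipartite graph \<open>K\<^sub>3\<^sub>,\<^sub>3\<close>: with vectors
  \<open>p\<^sub>i\<close> for the odd and \<open>q\<^sub>j\<close> for the even vertices, its lines are the covectors
  \<open>n\<^sub>i\<^sub>j = p\<^sub>i \<times> q\<^sub>j\<close>. What decides both claims is a \<^emph>\<open>stress\<close> of this drawing: weights
  \<open>\<omega>\<^sub>i\<^sub>j\<close> on the nine lines, not all zero, for which the weighted covectors sum to zero at each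
  of the six vertices.

  \<^item> A conic through the six points gives a stress (\<open>stress_if_on_conic\<close>; in rigidity theory
  this goes back to Bolker and Roth). The six points impose dependent conditions on quadrics, so
  \<open>\<Sum>\<alpha>\<^sub>i p\<^sub>i p\<^sub>i\<^sup>T + \<Sum>\<beta>\<^sub>j q\<^sub>j q\<^sub>j\<^sup>T = 0\<close>, and the weights can be read off from this identity when
  one of the two triples is not collinear. When both are, the two linear dependencies
  multiply to a stress.

  \<^item> A stress prevents 2-formality (\<open>not_two_formal_of_stress\<close>). Three lines with a linear relation
  are concurrent, hence meet in one of the six vertices, and there the relation is unique up to a
  factor: it consists of the weights. Summing these relations over the odd vertices gives the same
  vector as summing them over the even ones, so they span at most five dimensions of the relation
  space, which has at least \<open>9 - 3 = 6\<close>.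

  \<^item> No syzygy has degree below five (\<open>no_syzygy_below_5\<close>). Read a syzygy of degree \<open>k\<close> as a vector
  field \<open>\<delta>\<close>. It is tangent to every line, so \<open>v \<times> \<delta>(v)\<close>, of degree \<open>k + 1\<close>, vanishes where two
  lines meet. Every line carries six such points, two triple and four double ones, so for \<open>k < 5\<close>
  it vanishes on all nine lines, hence everywhere. Then \<open>\<delta>\<close> is a multiple of the Euler field,
  and by Euler's formula the only such syzygy is zero.

  \<^item> A stress gives a syzygy of degree five (\<open>syzygy_of_stress\<close>). On each line, the six points leave
  just one candidate up to a factor for the restriction of the sextic \<open>v \<times> \<delta>(v)\<close>, and the stress
  makes the candidates on the nine lines fit together to a sextic vector \<open>W\<close>. It is an explicit
  combination of sextics attached to the 4-cycles of \<open>K\<^sub>3\<^sub>,\<^sub>3\<close>. Since \<open>W\<close> is parallel to \<open>n\<^sub>i\<^sub>j\<close> along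
  each line, \<open>grad f \<times> W\<close> is divisible by \<open>f\<close>, and the quotient is orthogonal to \<open>grad f\<close>.

  Most of the argument is about polynomial functions on \<open>\<complex>\<^sup>3\<close>; the passage to and from formal
  polynomials is exact because a polynomial over \<open>\<complex>\<close> is determined by its values.
\<close>

section \<open>Dot product, cross product and bracket\<close>

text \<open>
  The bilinear pairing, without complex conjugation: covectors are represented by vectors.
\<close>

definition dot :: "complex^3 \<Rightarrow> complex^3 \<Rightarrow> complex" where
  "dot u v = u$1 * v$1 + u$2 * v$2 + u$3 * v$3"

definition cross :: "complex^3 \<Rightarrow> complex^3 \<Rightarrow> complex^3" where
  "cross u v = vector [u$2 * v$3 - u$3 * v$2, u$3 * v$1 - u$1 * v$3, u$1 * v$2 - u$2 * v$1]"

definition bracket :: "complex^3 \<Rightarrow> complex^3 \<Rightarrow> complex^3 \<Rightarrow> complex" where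
  "bracket a b c = dot (cross a b) c"

lemma cross_nth [simp]:
  "cross u v $ 1 = u$2 * v$3 - u$3 * v$2"
  "cross u v $ 2 = u$3 * v$1 - u$1 * v$3"
  "cross u v $ 3 = u$1 * v$2 - u$2 * v$1"
  by (simp_all add: cross_def)

lemma vec3_eq_iff: "u = v \<longleftrightarrow> u$1 = v$1 \<and> u$2 = v$2 \<and> u$3 = v$3" for u v :: "complex^3"
  by (simp add: vec_eq_iff forall_3)

lemma dot_linear:
  "dot n (u + v) = dot n u + dot n v" "dot n (u - v) = dot n u - dot n v"
  "dot n (c *s v) = c * dot n v" "dot n 0 = 0"
  "dot (u + v) n = dot u n + dot v n" "dot (u - v) n = dot u n - dot v n"
  "dot (c *s v) n = c * dot v n" "dot 0 n = 0" "dot n (- v) = - dot n v" "dot (- v) n = - dot v n"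
  by (simp_all add: dot_def algebra_simps)

lemma dot_commute: "dot u v = dot v u"
  by (simp add: dot_def algebra_simps)

lemma dot_sum: "dot n (sum f S) = (\<Sum>x\<in>S. dot n (f x))" "dot (sum f S) n = (\<Sum>x\<in>S. dot (f x) n)"
  by (induction S rule: infinite_finite_induct) (simp_all add: dot_linear)

lemma cross_linear:
  "cross n (u + v) = cross n u + cross n v" "cross n (u - v) = cross n u - cross n v"
  "cross n (c *s v) = c *s cross n v" "cross n 0 = 0"
  "cross (u + v) n = cross u n + cross v n" "cross (u - v) n = cross u n - cross v n"
  "cross (c *s v) n = c *s cross v n" "cross 0 n = 0" "cross n (- v) = - cross n v" "cross (- v) n = - cross v n"
  by (simp_all add: vec3_eq_iff algebra_simps)

lemma cross_sum: "cross n (sum f S) = (\<Sum>x\<in>S. cross n (f x))" "cross (sum f S) n = (\<Sum>x\<in>S. cross (f x) n)"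
  by (induction S rule: infinite_finite_induct) (simp_all add: cross_linear)

lemma cross_self [simp]: "cross v v = 0"
  by (simp add: vec3_eq_iff)

lemma cross_skew: "cross u v = - cross v u"
  by (simp add: vec3_eq_iff)

lemma dot_cross_self [simp]: "dot (cross u v) u = 0" "dot (cross u v) v = 0"
  by (simp_all add: dot_def algebra_simps)

lemma cross_cross: "cross (cross a b) (cross c d) = bracket a b d *s c - bracket a b c *s d"
  by (simp add: vec3_eq_iff bracket_def dot_def algebra_simps)

lemma triple_cross: "cross g (cross v d) = dot g d *s v - dot g v *s d"
  by (simp add: vec3_eq_iff dot_def algebra_simps)

lemma bracket_permute:
  "bracket b c a = bracket a b c" "bracket c a b = bracket a b c"
  "bracket b a c = - bracket a b c" "bracket a c b = - bracket a b c" "bracket c b a = - bracket a b c"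
  by (simp_all add: bracket_def dot_def algebra_simps)

lemma bracket_degenerate [simp]:
  "bracket a a b = 0" "bracket a b a = 0" "bracket b a a = 0"
  by (simp_all add: bracket_def dot_def algebra_simps)

text \<open>
  Cramer's rule without division.
\<close>

lemma bracket_expand:
  "bracket a b c *s v = bracket v b c *s a + bracket a v c *s b + bracket a b v *s c"
  by (simp add: vec3_eq_iff bracket_def dot_def algebra_simps)

lemma cross_eq_0_iff:
  assumes "u \<noteq> 0"
  shows "cross u v = 0 \<longleftrightarrow> (\<exists>c. v = c *s u)"
proof
  assume c: "cross u v = 0"
  then have e: "u$2 * v$3 = u$3 * v$2" "u$3 * v$1 = u$1 * v$3" "u$1 * v$2 = u$2 * v$1"
    by (simp_all add: vec3_eq_iff)
  consider "u$1 \<noteq> 0" | "u$2 \<noteq> 0" | "u$3 \<noteq> 0" using assms by (auto simp: vec3_eq_iff)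
  then show "\<exists>c. v = c *s u"
  proof cases
    case 1 then show ?thesis using e
      by (intro exI[of _ "v$1 / u$1"]) (simp add: vec3_eq_iff field_simps)
  next
    case 2 then show ?thesis using e
      by (intro exI[of _ "v$2 / u$2"]) (simp add: vec3_eq_iff field_simps)
  next
    case 3 then show ?thesis using e
      by (intro exI[of _ "v$3 / u$3"]) (simp add: vec3_eq_iff field_simps)
  qed
next
  assume "\<exists>c. v = c *s u" then show "cross u v = 0" by (auto simp: cross_linear)
qed

lemma dot_nondegenerate: "n \<noteq> 0 \<Longrightarrow> \<exists>v. dot n v \<noteq> 0"
proof -
  assume "n \<noteq> 0"
  then consider "n$1 \<noteq> 0" | "n$2 \<noteq> 0" | "n$3 \<noteq> 0" by (auto simp: vec3_eq_iff)
  then show ?thesis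
  proof cases
    case 1 then show ?thesis by (intro exI[of _ "vector [1, 0, 0]"]) (simp add: dot_def)
  next
    case 2 then show ?thesis by (intro exI[of _ "vector [0, 1, 0]"]) (simp add: dot_def)
  next
    case 3 then show ?thesis by (intro exI[of _ "vector [0, 0, 1]"]) (simp add: dot_def)
  qed
qed


section \<open>Homogeneous polynomial functions\<close>

text \<open>
  Building forms from products with linear forms makes the proofs below inductions on a product
  structure, free of exponents and coefficients.
\<close>

inductive form :: "nat \<Rightarrow> (complex^3 \<Rightarrow> complex) \<Rightarrow> bool" where
  const: "form 0 (\<lambda>_. c)"
| zero: "form k (\<lambda>_. 0)"
| dot_mult: "form k g \<Longrightarrow> form (Suc k) (\<lambda>v. dot n v * g v)"
| add: "form k g \<Longrightarrow> form k h \<Longrightarrow> form k (\<lambda>v. g v + h v)"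

lemma form_dot: "form 1 (dot n)"
  using form.dot_mult[OF form.const[of 1], of n] by simp

lemma form_scale: "form k g \<Longrightarrow> form k (\<lambda>v. c * g v)"
proof (induction rule: form.induct)
  case (const d) show ?case by (rule form.const)
next
  case (zero k) show ?case using form.zero by simp
next
  case (dot_mult k g n)
  from form.dot_mult[OF dot_mult.IH, of n] show ?case by (simp add: mult.left_commute)
next
  case (add k g h)
  from form.add[OF add.IH] show ?case by (simp add: distrib_left)
qed

lemma form_mult: "form j g \<Longrightarrow> form k h \<Longrightarrow> form (j + k) (\<lambda>v. g v * h v)"
proof (induction rule: form.induct)
  case (const d) then show ?case by (simp add: form_scale)
next
  case (zero k) show ?case using form.zero by simp
next
  case (dot_mult k g n)
  from form.dot_mult[OF dot_mult.IH, of n] dot_mult.prems show ?case by (simp add: mult.assoc)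
next
  case (add k g h)
  from form.add[OF add.IH] add.prems show ?case by (simp add: distrib_right)
qed

lemma form_sum: "(\<And>x. x \<in> S \<Longrightarrow> form k (g x)) \<Longrightarrow> form k (\<lambda>v. \<Sum>x\<in>S. g x v)"
  by (induction S rule: infinite_finite_induct) (simp_all add: form.zero form.add)

lemma form_diff: "form k g \<Longrightarrow> form k h \<Longrightarrow> form k (\<lambda>v. g v - h v)"
  using form.add[OF _ form_scale[of k h "-1"]] by simp

lemma form_prod: "finite S \<Longrightarrow> (\<And>x. x \<in> S \<Longrightarrow> form (d x) (g x)) \<Longrightarrow> form (\<Sum>x\<in>S. d x) (\<lambda>v. \<Prod>x\<in>S. g x v)"
  by (induction S rule: finite_induct) (simp_all add: form.const form_mult)

lemma form_prod_dot: "finite S \<Longrightarrow> form (card S) (\<lambda>v. \<Prod>x\<in>S. dot (n x) v)"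
  using form_prod[of S "\<lambda>_. 1" "\<lambda>x. dot (n x)"] form_dot by simp

lemma form_nth: "form 1 (\<lambda>v. v $ i)"
proof -
  have "i \<in> {1,2,3}" using exhaust_3[of i] by blast
  then have "\<exists>n. \<forall>v. v $ i = dot n v"
  proof (elim insertE)
    assume "i = 1" then show ?thesis by (intro exI[of _ "vector [1,0,0]"]) (simp add: dot_def)
  next
    assume "i = 2" then show ?thesis by (intro exI[of _ "vector [0,1,0]"]) (simp add: dot_def)
  next
    assume "i = 3" then show ?thesis by (intro exI[of _ "vector [0,0,1]"]) (simp add: dot_def)
  qed auto
  then obtain n where "\<And>v. v $ i = dot n v" by blast
  then show ?thesis using form_dot[of n] by simp
qed

lemma form_power_nth: "form k (\<lambda>v. (v $ i) ^ k)"
  by (induction k) (use form_mult[OF form_nth[of i]] form.const in fastforce)+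

lemma form_homogeneous: "form k g \<Longrightarrow> g (c *s v) = c ^ k * g v"
  by (induction rule: form.induct) (simp_all add: dot_linear algebra_simps)

text \<open>
  The coefficient of \<open>t\<^sup>k\<close> is the value at the point at infinity of the line. Knowing it lets a
  zero at that point be counted together with the finite ones.
\<close>

lemma form_on_line:
  assumes "form k g"
  shows "\<exists>P. degree P \<le> k \<and> coeff P k = g u \<and> (\<forall>t. poly P t = g (v + t *s u))"
  using assms
proof (induction rule: form.induct)
  case (const c) then show ?case by (intro exI[of _ "[:c:]"]) simp
next
  case (zero k) then show ?case by (intro exI[of _ "0"]) simp
next
  case (dot_mult k g n)
  then obtain P where P: "degree P \<le> k" "coeff P k = g u" "\<And>t. poly P t = g (v + t *s u)" by blast
  let ?L = "[:dot n v, dot n u:]"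
  have "degree (?L * P) \<le> degree ?L + degree P" by (rule degree_mult_le)
  also have "\<dots> \<le> Suc k" using P(1) degree_pCons_le[of "dot n v" "[:dot n u:]"] by simp
  finally have "degree (?L * P) \<le> Suc k" .
  moreover have "coeff P (Suc k) = 0" using P(1) by (simp add: coeff_eq_0)
  ultimately show ?case using P
    by (intro exI[of _ "?L * P"]) (simp add: dot_linear coeff_pCons algebra_simps)
next
  case (add k g h)
  then obtain P Q where "degree P \<le> k" "coeff P k = g u" "\<And>t. poly P t = g (v + t *s u)"
    "degree Q \<le> k" "coeff Q k = h u" "\<And>t. poly Q t = h (v + t *s u)" by blast
  then show ?case by (intro exI[of _ "P + Q"]) (simp add: degree_add_le)
qed

lemma poly_eq_0_if_many_roots:
  fixes P :: "complex poly"
  assumes "finite S" "degree P < card S" "\<And>t. t \<in> S \<Longrightarrow> poly P t = 0"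
  shows "P = 0"
proof (rule ccontr)
  assume "P \<noteq> 0"
  then have "card S \<le> card {t. poly P t = 0}"
    by (intro card_mono poly_roots_finite) (use assms(3) in auto)
  also have "\<dots> \<le> degree P" by (rule card_poly_roots_bound) fact
  finally show False using assms(2) by simp
qed

lemma finite_linear_zeros:
  fixes a b :: complex
  assumes "(a, b) \<noteq> (0, 0)"
  shows "finite {t. a + t * b = 0}"
proof -
  have "finite {t. poly [:a, b:] t = 0}" by (rule poly_roots_finite) (use assms in auto)
  then show ?thesis by simp
qed

text \<open>
  A form vanishing off finitely many hyperplanes vanishes at \<open>v\<close>, provided the line from \<open>v\<close> in
  the direction \<open>u\<close> lies in none of them: only finitely many points of the line are lost. The line
  may lie inside a further plane, so this also serves for forms known on one line of an arrangement.
\<close>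

lemma form_zero_by_density:
  assumes g: "form k g" and "finite E"
    and u: "\<And>e. e \<in> E \<Longrightarrow> (dot (n e) v, dot (n e) u) \<noteq> (0, 0)"
    and z: "\<And>t. (\<And>e. e \<in> E \<Longrightarrow> dot (n e) (v + t *s u) \<noteq> 0) \<Longrightarrow> g (v + t *s u) = 0"
  shows "g v = 0"
proof -
  obtain P where P: "\<And>t. poly P t = g (v + t *s u)" using form_on_line[OF g] by blast
  have fin: "finite (\<Union>e\<in>E. {t. dot (n e) v + t * dot (n e) u = 0})"
    using u \<open>finite E\<close> finite_linear_zeros by blast
  have "UNIV - (\<Union>e\<in>E. {t. dot (n e) v + t * dot (n e) u = 0}) \<subseteq> {t. poly P t = 0}"
    using z by (auto simp: P dot_linear)
  then have "infinite {t. poly P t = 0}"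
    using fin infinite_UNIV_char_0[where 'a=complex] by (meson Diff_infinite_finite infinite_super)
  then have "P = 0" using poly_roots_finite by blast
  then show ?thesis using P[of 0] by simp
qed

text \<open>
  On the moment curve \<open>(1, t, t\<^sup>2)\<close> every nonzero covector has finitely many zeros.
\<close>

lemma avoid_hyperplanes:
  assumes "finite E" "\<And>e. e \<in> E \<Longrightarrow> n e \<noteq> (0 :: complex^3)"
  shows "\<exists>u. \<forall>e\<in>E. dot (n e) u \<noteq> 0"
proof -
  define P where "P e = [:n e $ 1, n e $ 2, n e $ 3:]" for e
  have "P e \<noteq> 0" if "e \<in> E" for e using assms(2)[OF that] by (auto simp: P_def vec3_eq_iff)
  then have "finite (\<Union>e\<in>E. {t. poly (P e) t = 0})" using assms(1) poly_roots_finite by blast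
  then obtain t where "t \<notin> (\<Union>e\<in>E. {t. poly (P e) t = 0})"
    using ex_new_if_finite infinite_UNIV_char_0 by blast
  then show ?thesis
    by (intro exI[of _ "vector [1, t, t^2]"]) (auto simp: P_def dot_def algebra_simps power2_eq_square)
qed

text \<open>
  A generic line through \<open>v\<close> meets the given lines in more than \<open>k\<close> points, and these are distinct
  because no two of the given lines coincide. Genericity is again the avoidance of finitely many
  hyperplanes: for \<open>e \<noteq> e'\<close>, \<open>N (e, e')\<close> below is the covector whose zeros \<open>u\<close> send the line from \<open>v\<close>
  through the intersection of \<open>n e\<close> and \<open>n e'\<close>.
\<close>

lemma form_zero_if_zero_on_many_lines:
  assumes g: "form k g" and E: "finite E" "k < card E"
    and distinct: "\<And>e e'. e \<in> E \<Longrightarrow> e' \<in> E \<Longrightarrow> e \<noteq> e' \<Longrightarrow> cross (n e) (n e') \<noteq> 0"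
    and nz: "\<And>e. e \<in> E \<Longrightarrow> n e \<noteq> 0"
    and z: "\<And>e v. e \<in> E \<Longrightarrow> dot (n e) v = 0 \<Longrightarrow> g v = 0"
  shows "g v = 0"
proof (cases "\<exists>e\<in>E. dot (n e) v = 0")
  case True then show ?thesis using z by blast
next
  case off: False
  define N where "N = (\<lambda>(e, e'). if e = e' then n e else dot (n e) v *s n e' - dot (n e') v *s n e)"
  have "N x \<noteq> 0" if x: "x \<in> E \<times> E" for x
  proof
    assume 0: "N x = 0"
    obtain e e' where e: "x = (e, e')" "e \<in> E" "e' \<in> E" using x by blast
    show False
    proof (cases "e = e'")
      case True then show ?thesis using 0 e nz by (simp add: N_def)
    next
      case False
      then have "cross (n e) (dot (n e) v *s n e') = 0" using 0 e
        by (simp add: N_def cross_linear)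
      then show ?thesis using distinct[OF e(2,3) False] off e by (simp add: cross_linear)
    qed
  qed
  then have "\<exists>u. \<forall>x\<in>E \<times> E. dot (N x) u \<noteq> 0"
    using avoid_hyperplanes[of "E \<times> E" N] E(1) by blast
  then obtain u where u: "\<And>x. x \<in> E \<times> E \<Longrightarrow> dot (N x) u \<noteq> 0" by blast
  have u1: "dot (n e) u \<noteq> 0" if "e \<in> E" for e using u[of "(e,e)"] that by (simp add: N_def)
  define r where "r e = - dot (n e) v / dot (n e) u" for e
  have inj: "inj_on r E"
  proof (rule inj_onI, rule ccontr)
    fix e e' assume e: "e \<in> E" "e' \<in> E" "r e = r e'" "e \<noteq> e'"
    then have "dot (N (e, e')) u = 0" using u1[of e] u1[of e']
      by (simp add: N_def r_def dot_linear field_simps)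
    then show False using u[of "(e, e')"] e by simp
  qed
  obtain P where P: "degree P \<le> k" "\<And>t. poly P t = g (v + t *s u)" using form_on_line[OF g] by blast
  have "P = 0"
  proof (rule poly_eq_0_if_many_roots)
    show "finite (r ` E)" using E by simp
    show "degree P < card (r ` E)" using P(1) E(2) card_image[OF inj] by simp
    fix t assume "t \<in> r ` E"
    then obtain e where "e \<in> E" "t = r e" by blast
    then show "poly P t = 0" using z[of e "v + t *s u"] u1[of e]
      by (simp add: P(2) r_def dot_linear)
  qed
  then show ?thesis using P(2)[of 0] by simp
qed

text \<open>
  The projective line cut out by \<open>n\<close> is parametrised as \<open>v + t s\<^sub>0\<close> with one of the given zeros
  \<open>s\<^sub>0\<close> at infinity. The zero at infinity lowers the degree below \<open>k\<close>, and the other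
  zeros are still at least \<open>k\<close> in number.
\<close>

lemma form_zero_if_many_zeros_on_line:
  assumes g: "form k g" and S: "finite S" "k < card S"
    and l: "n \<noteq> 0" "\<And>s. s \<in> S \<Longrightarrow> dot n s = 0"
    and nz: "\<And>s. s \<in> S \<Longrightarrow> s \<noteq> 0"
    and distinct: "\<And>s s'. s \<in> S \<Longrightarrow> s' \<in> S \<Longrightarrow> s \<noteq> s' \<Longrightarrow> cross s s' \<noteq> 0"
    and z: "\<And>s. s \<in> S \<Longrightarrow> g s = 0"
    and v: "dot n v = 0"
  shows "g v = 0"
proof (cases "\<exists>s\<in>S. cross s v = 0")
  case True
  then obtain s c where "s \<in> S" "v = c *s s" using nz cross_eq_0_iff by blast
  then show ?thesis using z form_homogeneous[OF g] by simp
next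
  case off: False
  obtain s0 where s0: "s0 \<in> S" using S by (metis card.empty ex_in_conv not_less_zero)
  have ex: "\<exists>a b. a \<noteq> 0 \<and> a *s s = v + b *s s0" if s: "s \<in> S - {s0}" for s
  proof -
    have "cross s0 s \<noteq> 0" using distinct s s0 by auto
    have sv: "cross s v \<noteq> 0" "cross s0 v \<noteq> 0" using off s s0 by auto
    \<comment> \<open>vectors of the plane orthogonal to n have cross products parallel to n\<close>
    have par: "\<exists>c. cross x y = c *s n" if "dot n x = 0" "dot n y = 0" for x y
    proof -
      have "cross n (cross x y) = 0" using that by (simp add: triple_cross)
      then show ?thesis using cross_eq_0_iff[OF l(1)] by blast
    qed
    obtain a where a: "cross s0 s = a *s n" using par l(2) s s0 by blast
    obtain b where b: "cross s0 v = b *s n" using par l(2) s0 v by blast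
    have ab: "a \<noteq> 0" "b \<noteq> 0" using a b \<open>cross s0 s \<noteq> 0\<close> sv by auto
    have "cross s0 ((b/a) *s s - v) = 0" using a b ab by (simp add: cross_linear vec3_eq_iff)
    then obtain c where "(b/a) *s s - v = c *s s0" using cross_eq_0_iff nz[OF s0] by blast
    then have "(b/a) *s s = v + c *s s0" by (simp add: algebra_simps)
    then show ?thesis using ab by (intro exI[of _ "b/a"] exI[of _ c]) simp
  qed
  then obtain a b where ab: "\<And>s. s \<in> S - {s0} \<Longrightarrow> a s \<noteq> 0 \<and> a s *s s = v + b s *s s0"
    by metis
  have inj: "inj_on b (S - {s0})"
  proof (rule inj_onI, rule ccontr)
    fix s s' assume e: "s \<in> S - {s0}" "s' \<in> S - {s0}" "b s = b s'" "s \<noteq> s'"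
    then have "a s *s s = a s' *s s'" using ab by metis
    then have "cross s (a s *s s) = a s' *s cross s s'" by (simp add: cross_linear)
    then have "a s' *s cross s s' = 0" by (simp add: cross_linear)
    then show False using ab[OF e(2)] distinct[of s s'] e by simp
  qed
  obtain P where P: "degree P \<le> k" "coeff P k = g s0" "\<And>t. poly P t = g (v + t *s s0)"
    using form_on_line[OF g] by blast
  have roots: "poly P t = 0" if t: "t \<in> b ` (S - {s0})" for t
  proof -
    obtain s where s: "s \<in> S - {s0}" "t = b s" using t by blast
    then have "poly P t = g (a s *s s)" using ab P by simp
    also have "\<dots> = 0" using form_homogeneous[OF g] z s by simp
    finally show ?thesis .
  qed
  have "P = 0"
  proof (rule ccontr)
    assume "P \<noteq> 0"
    have "degree P \<noteq> k" using P(2) z[OF s0] \<open>P \<noteq> 0\<close> by (metis leading_coeff_0_iff)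
    then have "degree P < card (b ` (S - {s0}))" using P(1) S s0 card_image[OF inj] by simp
    then have "P = 0" by (intro poly_eq_0_if_many_roots[OF _ _ roots]) (use S in auto)
    then show False using \<open>P \<noteq> 0\<close> by simp
  qed
  then show ?thesis using P(3)[of 0] by simp
qed

lemma form_linear_substitution:
  assumes "form k g" and pi: "\<And>v. \<pi> v = v - dot n v *s e"
  shows "form k (\<lambda>v. g (\<pi> v))"
  using assms(1)
proof (induction rule: form.induct)
  case (dot_mult k g m)
  have "dot m (\<pi> v) = dot (m - dot m e *s n) v" for v by (simp add: pi dot_linear)
  then show ?case using form.dot_mult[OF dot_mult.IH] by simp
qed (auto intro: form.intros)

text \<open>
  Along the projection \<open>\<pi>\<close> onto the plane \<open>n = 0\<close>, the difference \<open>g - g \<circ> \<pi>\<close> is a multiple of \<open>n\<close>: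
  this is clear for linear forms and passes to products. For \<open>g\<close> vanishing on the plane the term
  \<open>g \<circ> \<pi>\<close> is zero. The quotient has degree \<open>k - 1\<close>, which for constant \<open>g\<close> is a truncated
  subtraction; therefore the induction carries along that the quotient is then zero.
\<close>

lemma form_divisible:
  assumes g: "form (Suc k) g" and n: "n \<noteq> 0" and z: "\<And>v. dot n v = 0 \<Longrightarrow> g v = 0"
  shows "\<exists>h. form k h \<and> (\<forall>v. g v = dot n v * h v)"
proof -
  obtain e0 where "dot n e0 \<noteq> 0" using dot_nondegenerate[OF n] by blast
  define e where "e = (1 / dot n e0) *s e0"
  have e: "dot n e = 1" using \<open>dot n e0 \<noteq> 0\<close> by (simp add: e_def dot_linear)
  define \<pi> where "\<pi> v = v - dot n v *s e" for v
  have split: "\<exists>h. (k = 0 \<longrightarrow> (\<forall>v. h v = 0)) \<and> form (k - 1) h \<and> (\<forall>v. g v = dot n v * h v + g (\<pi> v))" if "form k g" for k g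
    using that
  proof (induction rule: form.induct)
    case (const c) then show ?case by (auto intro!: exI[of _ "\<lambda>_. 0"] form.zero)
  next
    case (zero k) then show ?case by (auto intro!: exI[of _ "\<lambda>_. 0"] form.zero)
  next
    case (dot_mult k g m)
    then obtain h where h: "k = 0 \<Longrightarrow> (\<forall>v. h v = 0)" "form (k - 1) h" "\<And>v. g v = dot n v * h v + g (\<pi> v)" by blast
    have "form k (\<lambda>v. dot m v * h v)"
      using form.dot_mult[OF h(2), of m] h(1) form.zero[of k] by (cases k) auto
    moreover have "form k (\<lambda>v. g (\<pi> v))" by (rule form_linear_substitution[OF dot_mult.hyps \<pi>_def])
    ultimately have f: "form k (\<lambda>v. dot m v * h v + dot m e * g (\<pi> v))"
      by (intro form.add form_scale)
    have eq: "dot m v * g v = dot n v * (dot m v * h v + dot m e * g (\<pi> v)) + dot m (\<pi> v) * g (\<pi> v)" for v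
    proof -
      have m: "dot m v = dot m (\<pi> v) + dot n v * dot m e" by (simp add: \<pi>_def dot_linear)
      have "dot m v * g v = dot m v * (dot n v * h v) + dot m v * g (\<pi> v)"
        by (subst h(3)[of v]) (simp add: distrib_left)
      also have "dot m v * g (\<pi> v) = dot m (\<pi> v) * g (\<pi> v) + dot n v * dot m e * g (\<pi> v)"
        by (subst m) (simp add: distrib_right)
      finally show ?thesis by (simp add: algebra_simps)
    qed
    show ?case
    proof (intro exI conjI allI)
      show "form (Suc k - 1) (\<lambda>v. dot m v * h v + dot m e * g (\<pi> v))" using f by simp
    qed (simp, rule eq)
  next
    case (add k g g')
    then obtain h h' where h: "k = 0 \<longrightarrow> (\<forall>v. h v = 0)" "form (k - 1) h" "\<And>v. g v = dot n v * h v + g (\<pi> v)"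
       "k = 0 \<longrightarrow> (\<forall>v. h' v = 0)" "form (k - 1) h'" "\<And>v. g' v = dot n v * h' v + g' (\<pi> v)" by blast
    have eq: "g v + g' v = dot n v * (h v + h' v) + (g (\<pi> v) + g' (\<pi> v))" for v
      by (subst h(3)[of v], subst h(6)[of v]) (simp add: distrib_left)
    have "form (k - 1) (\<lambda>v. h v + h' v)" using h by (intro form.add)
    then show ?case using h(1,4)
      by (intro exI[of _ "\<lambda>v. h v + h' v"] conjI allI eq) auto
  qed
  obtain h where h: "form k h" "\<And>v. g v = dot n v * h v + g (\<pi> v)" using split[OF g] by auto
  have "dot n (\<pi> v) = 0" for v by (simp add: \<pi>_def dot_linear e)
  then show ?thesis using h z by auto
qed

section \<open>Polynomials and their values\<close>

lemma eval3_superset: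
  assumes "finite S" "Poly_Mapping.keys p \<subseteq> S"
  shows "eval3 p v = (\<Sum>e\<in>S. Poly_Mapping.lookup p e * (\<Prod>i\<in>UNIV. (v $ i) ^ Poly_Mapping.lookup e i))"
  unfolding eval3_def
  by (rule sum.mono_neutral_left) (use assms in \<open>auto simp: in_keys_iff\<close>)

lemma eval3_single [simp]:
  "eval3 (Poly_Mapping.single e c) v = c * (\<Prod>i\<in>UNIV. (v $ i) ^ Poly_Mapping.lookup e i)"
  by (subst eval3_superset[of "{e}"]) auto

lemma eval3_zero [simp]: "eval3 0 v = 0"
  by (simp add: eval3_def)

lemma eval3_add [simp]: "eval3 (p + q) v = eval3 p v + eval3 q v"
proof -
  let ?S = "Poly_Mapping.keys p \<union> Poly_Mapping.keys q"
  have "Poly_Mapping.keys (p + q) \<subseteq> ?S" by (rule keys_add)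
  then show ?thesis
    by (simp add: eval3_superset[of ?S] lookup_add distrib_right sum.distrib)
qed

lemma eval3_sum: "eval3 (sum f S) v = (\<Sum>x\<in>S. eval3 (f x) v)"
  by (induction S rule: infinite_finite_induct) simp_all

lemma poly3_expand: "p = (\<Sum>e\<in>Poly_Mapping.keys p. Poly_Mapping.single e (Poly_Mapping.lookup p e))"
  for p :: poly3
proof (rule poly_mapping_eqI)
  fix e
  have *: "Poly_Mapping.lookup (\<Sum>e\<in>S. Poly_Mapping.single e (Poly_Mapping.lookup p e)) e
      = (\<Sum>e'\<in>S. Poly_Mapping.lookup (Poly_Mapping.single e' (Poly_Mapping.lookup p e')) e)" for S
    by (induction S rule: infinite_finite_induct) (simp_all add: lookup_add)
  show "Poly_Mapping.lookup p e = Poly_Mapping.lookup (\<Sum>e\<in>Poly_Mapping.keys p. Poly_Mapping.single e (Poly_Mapping.lookup p e)) e"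
    by (auto simp: * lookup_single when_def in_keys_iff)
qed

lemma eval3_mult_single:
  "eval3 (Poly_Mapping.single a c * Poly_Mapping.single b d) v
    = eval3 (Poly_Mapping.single a c) v * eval3 (Poly_Mapping.single b d) v"
  by (simp add: mult_single lookup_add power_add prod.distrib algebra_simps del: prod_constant)

lemma eval3_mult [simp]: "eval3 (p * q) v = eval3 p v * eval3 q v"
proof -
  let ?s = "\<lambda>p e. Poly_Mapping.single e (Poly_Mapping.lookup p e)"
  have "p * q = (\<Sum>e\<in>Poly_Mapping.keys p. ?s p e) * (\<Sum>e\<in>Poly_Mapping.keys q. ?s q e)"
    using poly3_expand by metis
  then have "eval3 (p * q) v = (\<Sum>e\<in>Poly_Mapping.keys p. \<Sum>e'\<in>Poly_Mapping.keys q. eval3 (?s p e * ?s q e') v)"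
    by (simp only: sum_product eval3_sum)
  also have "\<dots> = (\<Sum>e\<in>Poly_Mapping.keys p. eval3 (?s p e) v) * (\<Sum>e\<in>Poly_Mapping.keys q. eval3 (?s q e) v)"
    by (simp only: eval3_mult_single sum_product)
  also have "\<dots> = eval3 p v * eval3 q v"
    by (simp only: eval3_sum[symmetric] poly3_expand[symmetric])
  finally show ?thesis .
qed

lemma eval3_one [simp]: "eval3 1 v = 1"
  using eval3_single[of 0 1 v] by (simp del: eval3_single)

lemma eval3_const3 [simp]: "eval3 (const3 c) v = c"
  by (simp add: const3_def)

lemma eval3_prod: "eval3 (prod f S) v = (\<Prod>x\<in>S. eval3 (f x) v)"
  by (induction S rule: infinite_finite_induct) simp_all

lemma prod_3: "prod f (UNIV :: 3 set) = f 1 * f 2 * f 3"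
  unfolding UNIV_3 by (simp add: ac_simps)

lemma base_expansion_unique:
  fixes a b N :: nat
  assumes "a + N * x = b + N * y" "a < N" "b < N"
  shows "a = b \<and> x = y"
proof -
  have "(a + N * x) mod N = (b + N * y) mod N" using assms(1) by (rule arg_cong)
  then have "a = b" using assms(2,3) by simp
  then show ?thesis using assms by simp
qed

text \<open>
  Kronecker's substitution \<open>(t, t\<^sup>N, t\<^sup>N\<^sup>*\<^sup>N)\<close>, with \<open>N\<close> larger than every exponent, sends distinct
  monomials to distinct powers of \<open>t\<close>.
\<close>

lemma eval3_eq_0_imp:
  assumes "\<And>v. eval3 p v = 0"
  shows "p = 0"
proof -
  let ?K = "Poly_Mapping.keys p"
  define N where "N = Suc (\<Sum>e\<in>?K. \<Sum>i\<in>UNIV. Poly_Mapping.lookup e i)"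
  have N: "Poly_Mapping.lookup e i < N" if "e \<in> ?K" for e i
  proof -
    have "Poly_Mapping.lookup e i \<le> (\<Sum>i\<in>UNIV. Poly_Mapping.lookup e i)"
      by (rule member_le_sum) auto
    also have "\<dots> \<le> (\<Sum>e\<in>?K. \<Sum>i\<in>UNIV. Poly_Mapping.lookup e i)"
      by (rule member_le_sum) (use that in auto)
    finally show ?thesis by (simp add: N_def)
  qed
  define \<kappa> where "\<kappa> e = Poly_Mapping.lookup e 1 + N * (Poly_Mapping.lookup e 2 + N * Poly_Mapping.lookup e 3)"
    for e :: "3 \<Rightarrow>\<^sub>0 nat"
  have inj: "inj_on \<kappa> ?K"
  proof (rule inj_onI)
    fix d e assume de: "d \<in> ?K" "e \<in> ?K" "\<kappa> d = \<kappa> e"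
    have 1: "Poly_Mapping.lookup d 1 = Poly_Mapping.lookup e 1 \<and>
       Poly_Mapping.lookup d 2 + N * Poly_Mapping.lookup d 3 = Poly_Mapping.lookup e 2 + N * Poly_Mapping.lookup e 3"
      using de N by (intro base_expansion_unique) (auto simp: \<kappa>_def)
    have 2: "Poly_Mapping.lookup d 2 = Poly_Mapping.lookup e 2 \<and> Poly_Mapping.lookup d 3 = Poly_Mapping.lookup e 3"
      using 1 de N by (intro base_expansion_unique) auto
    show "d = e" by (rule poly_mapping_eqI) (metis 1 2 exhaust_3)
  qed
  define P where "P = (\<Sum>e\<in>?K. monom (Poly_Mapping.lookup p e) (\<kappa> e))"
  have "poly P t = 0" for t
  proof -
    have "poly P t = eval3 p (vector [t, t ^ N, t ^ (N * N)])"
      unfolding P_def eval3_def poly_sum poly_monom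
      by (rule sum.cong) (simp_all add: prod_3 \<kappa>_def power_add power_mult algebra_simps)
    then show ?thesis using assms by simp
  qed
  then have "P = 0" using poly_all_0_iff_0 by blast
  have "Poly_Mapping.lookup p e = 0" if "e \<in> ?K" for e
  proof -
    have "coeff P (\<kappa> e) = (\<Sum>d\<in>?K. if d = e then Poly_Mapping.lookup p d else 0)"
      unfolding P_def coeff_sum
      by (rule sum.cong) (use inj that in \<open>auto simp: inj_on_def\<close>)
    also have "\<dots> = Poly_Mapping.lookup p e" using that by simp
    finally show ?thesis using \<open>P = 0\<close> by simp
  qed
  then have "Poly_Mapping.lookup p e = 0" for e by (cases "e \<in> ?K") (auto simp: in_keys_iff)
  then show ?thesis by (intro poly_mapping_eqI) simp
qed

lemma form_eval3:
  assumes "p \<in> homogeneous k"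
  shows "form k (eval3 p)"
proof -
  have "form k (\<lambda>v. \<Sum>e\<in>Poly_Mapping.keys p. Poly_Mapping.lookup p e * (\<Prod>i\<in>UNIV. (v $ i) ^ Poly_Mapping.lookup e i))"
  proof (intro form_sum form_scale)
    fix e assume "e \<in> Poly_Mapping.keys p"
    then have "(\<Sum>i\<in>UNIV. Poly_Mapping.lookup e i) = k" using assms by (simp add: homogeneous_def)
    then show "form k (\<lambda>v. \<Prod>i\<in>UNIV. (v $ i) ^ Poly_Mapping.lookup e i)"
      using form_prod[of UNIV "Poly_Mapping.lookup e" "\<lambda>i v. (v $ i) ^ Poly_Mapping.lookup e i"] form_power_nth by simp
  qed
  then show ?thesis by (simp add: eval3_def[abs_def])
qed

lemma homogeneous_zero: "0 \<in> homogeneous k"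
  by (simp add: homogeneous_def)

lemma homogeneous_add: "p \<in> homogeneous k \<Longrightarrow> q \<in> homogeneous k \<Longrightarrow> p + q \<in> homogeneous k"
  using keys_add[of p q] by (auto simp: homogeneous_def)

lemma homogeneous_mult: "p \<in> homogeneous j \<Longrightarrow> q \<in> homogeneous k \<Longrightarrow> p * q \<in> homogeneous (j + k)"
  using keys_mult[of p q] by (force simp: homogeneous_def lookup_add sum.distrib)

lemma homogeneous_const: "const3 c \<in> homogeneous 0"
  by (simp add: homogeneous_def const3_def)

definition lin3 :: "complex^3 \<Rightarrow> poly3" where
  "lin3 n = (\<Sum>i\<in>UNIV. Poly_Mapping.single (Poly_Mapping.single i 1) (n $ i))"

lemma lin3_homogeneous: "lin3 n \<in> homogeneous 1"
proof -
  have "Poly_Mapping.single (Poly_Mapping.single i 1) c \<in> homogeneous 1" for c :: complex and i :: 3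
    by (simp add: homogeneous_def lookup_single when_def)
  then show ?thesis by (simp add: lin3_def sum_3 homogeneous_add)
qed

lemma eval3_lin3 [simp]: "eval3 (lin3 n) v = dot n v"
  by (simp add: lin3_def sum_3 dot_def prod_3 lookup_single when_def)

lemma form_imp_homogeneous:
  "form k g \<Longrightarrow> \<exists>p\<in>homogeneous k. eval3 p = g"
proof (induction rule: form.induct)
  case (const c) then show ?case by (intro bexI[of _ "const3 c"] homogeneous_const) auto
next
  case (zero k) then show ?case by (intro bexI[of _ 0] homogeneous_zero) auto
next
  case (dot_mult k g n)
  then obtain p where "p \<in> homogeneous k" "eval3 p = g" by blast
  then show ?case using homogeneous_mult[OF lin3_homogeneous[of n], of p k]
    by (intro bexI[of _ "lin3 n * p"]) auto
next
  case (add k g h)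
  then obtain p q where "p \<in> homogeneous k" "eval3 p = g" "q \<in> homogeneous k" "eval3 q = h" by blast
  then show ?case by (intro bexI[of _ "p + q"] homogeneous_add) auto
qed

lemma form_1_imp_dot: "form 1 g \<Longrightarrow> \<exists>n. g = dot n"
proof -
  have *: "(k = 0 \<longrightarrow> (\<exists>c. g = (\<lambda>_. c))) \<and> (k = 1 \<longrightarrow> (\<exists>n. g = dot n))" if "form k g" for k g
    using that
  proof (induction rule: form.induct)
    case (zero k)
    have "(\<lambda>_. 0) = dot 0" by (auto simp: dot_linear)
    then show ?case by blast
  next
    case (dot_mult k g n)
    { assume "k = 0"
      then obtain c where "g = (\<lambda>_. c)" using dot_mult.IH by blast
      then have "(\<lambda>v. dot n v * g v) = dot (c *s n)" by (auto simp: dot_linear)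
      then have "\<exists>m. (\<lambda>v. dot n v * g v) = dot m" by blast }
    then show ?case by auto
  next
    case (add k g h)
    { fix n m assume "g = dot n" "h = dot m"
      then have "(\<lambda>v. g v + h v) = dot (n + m)" by (auto simp: dot_linear) }
    then show ?case using add.IH by blast
  qed auto
  then show "form 1 g \<Longrightarrow> \<exists>n. g = dot n" by blast
qed

lemma linear_form_coefficients:
  assumes "l \<in> homogeneous 1"
  obtains n where "\<And>v. eval3 l v = dot n v" "l \<noteq> 0 \<Longrightarrow> n \<noteq> 0"
proof -
  obtain n where n: "eval3 l = dot n" using form_1_imp_dot form_eval3[OF assms] by blast
  moreover have "n \<noteq> 0" if "l \<noteq> 0" using that n eval3_eq_0_imp[of l] by (auto simp: dot_linear)
  ultimately show ?thesis using that by metis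
qed

text \<open>
  The link from the formal to the analytic derivative, from which the product rule for the formal
  derivative of a product of linear forms is inherited.
\<close>

lemma has_field_derivative_eval3:
  "((\<lambda>t. eval3 p (v + t *s axis i 1)) has_field_derivative eval3 (pderiv3 i p) v) (at 0)"
proof -
  have mono: "((\<lambda>t. \<Prod>j\<in>UNIV. ((v + t *s axis i 1) $ j) ^ Poly_Mapping.lookup e j) has_field_derivative
      of_nat (Poly_Mapping.lookup e i) * (\<Prod>j\<in>UNIV. (v $ j) ^ Poly_Mapping.lookup (e - Poly_Mapping.single i 1) j)) (at 0)"
    for e :: "3 \<Rightarrow>\<^sub>0 nat"
  proof -
    have *: "(v + t *s axis i 1) $ j = (if j = i then v $ i + t else v $ j)" for j t
      by (simp add: axis_def)
    have split: "(\<Prod>j\<in>UNIV. h j) = h i * (\<Prod>j\<in>UNIV - {i}. h j)" for h :: "3 \<Rightarrow> complex"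
      by (rule prod.remove) auto
    have "(\<lambda>t. \<Prod>j\<in>UNIV. ((v + t *s axis i 1) $ j) ^ Poly_Mapping.lookup e j) =
      (\<lambda>t. (v $ i + t) ^ Poly_Mapping.lookup e i * (\<Prod>j\<in>UNIV - {i}. (v $ j) ^ Poly_Mapping.lookup e j))"
      by (rule ext, subst split) (unfold *, auto intro!: arg_cong2[where f="(*)"] prod.cong)
    moreover have "(\<Prod>j\<in>UNIV. (v $ j) ^ Poly_Mapping.lookup (e - Poly_Mapping.single i 1) j)
       = (v $ i) ^ (Poly_Mapping.lookup e i - 1) * (\<Prod>j\<in>UNIV - {i}. (v $ j) ^ Poly_Mapping.lookup e j)"
      by (subst split) (auto simp: lookup_minus lookup_single intro!: prod.cong)
    ultimately show ?thesis
      by (auto intro!: derivative_eq_intros simp: algebra_simps)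
  qed
  have "eval3 (pderiv3 i p) v = (\<Sum>e\<in>Poly_Mapping.keys p. Poly_Mapping.lookup p e *
     (of_nat (Poly_Mapping.lookup e i) * (\<Prod>j\<in>UNIV. (v $ j) ^ Poly_Mapping.lookup (e - Poly_Mapping.single i 1) j)))"
    unfolding pderiv3_def eval3_sum eval3_single by (simp add: algebra_simps)
  moreover have "((\<lambda>t. eval3 p (v + t *s axis i 1)) has_field_derivative (\<Sum>e\<in>Poly_Mapping.keys p. Poly_Mapping.lookup p e *
     (of_nat (Poly_Mapping.lookup e i) * (\<Prod>j\<in>UNIV. (v $ j) ^ Poly_Mapping.lookup (e - Poly_Mapping.single i 1) j)))) (at 0)"
    unfolding eval3_def by (intro DERIV_sum DERIV_cmult mono)
  ultimately show ?thesis by simp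
qed

lemma pderiv3_prod_linear:
  fixes m :: "'d::finite \<Rightarrow> poly3"
  assumes n: "\<And>d v. eval3 (m d) v = dot (n d) v"
  shows "eval3 (pderiv3 i (arr_poly m)) v = (\<Sum>d\<in>UNIV. n d $ i * (\<Prod>d'\<in>UNIV - {d}. dot (n d') v))"
proof -
  have ax: "dot u (axis i 1) = u $ i" for u
    using exhaust_3[of i] by (auto simp: dot_def axis_def)
  have "((\<lambda>t. \<Prod>d\<in>UNIV. dot (n d) v + t * n d $ i) has_field_derivative
     (\<Sum>d\<in>UNIV. n d $ i * (\<Prod>d'\<in>UNIV - {d}. dot (n d') v))) (at 0)"
    by (rule DERIV_cong[OF has_field_derivative_prod])
       (auto intro!: derivative_eq_intros)
  moreover have "(\<lambda>t. eval3 (arr_poly m) (v + t *s axis i 1)) = (\<lambda>t. \<Prod>d\<in>UNIV. dot (n d) v + t * n d $ i)"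
    by (rule ext) (simp add: arr_poly_def eval3_prod n dot_linear ax)
  ultimately show ?thesis
    using has_field_derivative_eval3[of "arr_poly m" v i] DERIV_unique by simp
qed

section \<open>Nine lines joining two triples of points\<close>

locale k33_lines =
  fixes p q :: "3 \<Rightarrow> complex^3"
  assumes sides_distinct: "\<And>i j i' j'. (i, j) \<noteq> (i', j') \<Longrightarrow> cross (cross (p i) (q j)) (cross (p i') (q j')) \<noteq> 0"
begin

definition side :: "3 \<times> 3 \<Rightarrow> complex^3" where
  "side e = cross (p (fst e)) (q (snd e))"

lemma side_distinct: "e \<noteq> e' \<Longrightarrow> cross (side e) (side e') \<noteq> 0"
  using sides_distinct[of "fst e" "snd e" "fst e'" "snd e'"] by (auto simp: side_def prod_eq_iff)

lemma side_nonzero: "side e \<noteq> 0"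
proof -
  obtain e' where "e' \<noteq> e" by (metis UNIV_I UNIV_eq_I card.empty card_1_singleton_iff one_neq_zero prod.inject zero_neq_one)
  then show ?thesis using side_distinct[of e e'] by (auto simp: cross_linear)
qed

lemma vertex_on_side: "dot (side (i, j)) (p i) = 0" "dot (side (i, j)) (q j) = 0"
  by (simp_all add: side_def)

text \<open>
  If \<open>p i\<close> lay on a line through \<open>p i'\<close> and \<open>q j\<close>, that line would coincide with the one
  joining \<open>p i\<close> to \<open>q j\<close>.
\<close>

lemma p_off_side: "i' \<noteq> i \<Longrightarrow> bracket (p i') (q j) (p i) \<noteq> 0"
  and q_off_side: "j' \<noteq> j \<Longrightarrow> bracket (p i) (q j') (q j) \<noteq> 0"
proof -
  show "bracket (p i') (q j) (p i) \<noteq> 0" if "i' \<noteq> i"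
  proof -
    have "bracket (p i) (q j) (p i') \<noteq> 0"
      using sides_distinct[of i j i' j] that by (auto simp: cross_cross)
    then show ?thesis using bracket_permute(5)[of "p i'" "q j" "p i"] by simp
  qed
  show "bracket (p i) (q j') (q j) \<noteq> 0" if "j' \<noteq> j"
  proof -
    have "bracket (p i) (q j) (q j') \<noteq> 0"
      using sides_distinct[of i j i j'] that by (auto simp: cross_cross)
    then show ?thesis using bracket_permute(4)[of "p i" "q j" "q j'"] by simp
  qed
qed

lemma side_through_p_iff: "dot (side e) (p i) = 0 \<longleftrightarrow> fst e = i"
  using p_off_side[of "fst e" i "snd e"] by (auto simp: side_def bracket_def)

lemma side_through_q_iff: "dot (side e) (q j) = 0 \<longleftrightarrow> snd e = j"
  using q_off_side[of "snd e" j "fst e"] by (auto simp: side_def bracket_def)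

lemma p_nonzero: "p i \<noteq> 0" and q_nonzero: "q j \<noteq> 0"
  using side_nonzero[of "(i, j)"] by (auto simp: side_def cross_linear)

end

text \<open>
  The assumption excludes triple points other than the six vertices. It is phrased for lines: three
  of them are linearly dependent only if they share a vertex.
\<close>

locale k33_arrangement = k33_lines +
  assumes concurrent_imp_vertex:
    "\<And>i j i' j' i'' j''. distinct [(i, j), (i', j'), (i'', j'')] \<Longrightarrow>
       bracket (cross (p i) (q j)) (cross (p i') (q j')) (cross (p i'') (q j'')) = 0 \<Longrightarrow>
       i = i' \<and> i' = i'' \<or> j = j' \<and> j' = j''"
begin

section \<open>No syzygy of degree below five\<close>

text \<open>
  The gradient of the product of the nine linear forms.
\<close>

definition grad :: "complex^3 \<Rightarrow> complex^3" where
  "grad v = (\<Sum>e\<in>UNIV. (\<Prod>e'\<in>UNIV - {e}. dot (side e') v) *s side e)"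

lemma on_side_off_others:
  assumes "dot (side e) v = 0"
  shows "\<exists>u. dot (side e) u = 0 \<and> (\<forall>e'\<in>UNIV - {e}. dot (side e') u \<noteq> 0)"
proof -
  obtain i j where e: "e = (i, j)" by force
  have "finite (\<Union>e'\<in>UNIV - {e}. {t. dot (side e') (p i) + t * dot (side e') (q j) = 0})"
    by (intro finite_UN_I finite_linear_zeros) (auto simp: side_through_p_iff side_through_q_iff e prod_eq_iff)
  then obtain t where t: "t \<notin> (\<Union>e'\<in>UNIV - {e}. {t. dot (side e') (p i) + t * dot (side e') (q j) = 0})"
    using ex_new_if_finite infinite_UNIV_char_0 by blast
  show ?thesis
    by (rule exI[of _ "p i + t *s q j"]) (use t in \<open>auto simp: dot_linear e vertex_on_side\<close>)
qed

text \<open>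
  Along one line, the points on other lines are finitely many and may be ignored.
\<close>

lemma form_zero_on_side:
  assumes g: "form k g"
    and z: "\<And>v. dot (side e) v = 0 \<Longrightarrow> (\<forall>e'\<in>UNIV - {e}. dot (side e') v \<noteq> 0) \<Longrightarrow> g v = 0"
    and v: "dot (side e) v = 0"
  shows "g v = 0"
proof -
  obtain u where u: "dot (side e) u = 0" "\<And>e'. e' \<in> UNIV - {e} \<Longrightarrow> dot (side e') u \<noteq> 0"
    using on_side_off_others v by blast
  show ?thesis
    by (rule form_zero_by_density[OF g, of "UNIV - {e}" side v u])
       (use u v in \<open>auto intro!: z simp: dot_linear\<close>)
qed

lemma form_zero_off_sides:
  assumes g: "form k g" and z: "\<And>v. (\<forall>e. dot (side e) v \<noteq> 0) \<Longrightarrow> g v = 0"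
  shows "g v = 0"
proof -
  obtain u where u: "\<And>e. dot (side e) u \<noteq> 0"
    using avoid_hyperplanes[of UNIV side] side_nonzero by auto
  show ?thesis
    by (rule form_zero_by_density[OF g, of UNIV side v u]) (use u in \<open>auto intro!: z\<close>)
qed

lemma card_sides: "card (UNIV :: (3 \<times> 3) set) = 9"
  by (simp add: card_cartesian_product flip: UNIV_Times_UNIV)

lemma form_zero_if_zero_on_sides:
  assumes g: "form k g" "k < 9" and z: "\<And>e v. dot (side e) v = 0 \<Longrightarrow> g v = 0"
  shows "g v = 0"
  by (rule form_zero_if_zero_on_many_lines[OF g(1), of UNIV side])
     (use g z side_distinct side_nonzero card_sides in auto)

lemma form_cross_component:
  assumes "\<And>i. form k (\<lambda>v. \<delta> v $ i)"
  shows "form (Suc k) (\<lambda>v. cross v (\<delta> v) $ i)"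
proof -
  have "form (Suc k) (\<lambda>v. v $ a * \<delta> v $ b - v $ c * \<delta> v $ d)" for a b c d
    using form_diff[OF form_mult[OF form_nth[of a] assms[of b]] form_mult[OF form_nth[of c] assms[of d]]] by simp
  then show ?thesis using exhaust_3[of i] by auto
qed

lemma form_dot_component:
  assumes "\<And>i. form k (\<lambda>v. \<delta> v $ i)"
  shows "form k (\<lambda>v. dot n (\<delta> v))"
  unfolding dot_def by (intro form.add form_scale assms)

text \<open>
  The summands of the product rule other than the one for \<open>e\<close> contain the factor of \<open>e\<close>.
\<close>

lemma grad_on_side:
  assumes "dot (side e) v = 0"
  shows "grad v = (\<Prod>e'\<in>UNIV - {e}. dot (side e') v) *s side e"
proof -
  have "(\<Prod>e''\<in>UNIV - {e'}. dot (side e'') v) = 0" if "e' \<noteq> e" for e'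
    by (rule prod_zero) (use that assms in auto)
  then have "grad v = (\<Sum>e'\<in>UNIV. if e' = e then (\<Prod>e'\<in>UNIV - {e}. dot (side e') v) *s side e else 0)"
    unfolding grad_def by (intro sum.cong) auto
  then show ?thesis by simp
qed

lemma euler: "dot (grad v) v = 9 * (\<Prod>e\<in>UNIV. dot (side e) v)"
proof -
  have "dot (grad v) v = (\<Sum>e\<in>(UNIV :: (3 \<times> 3) set). \<Prod>e\<in>UNIV. dot (side e) v)"
    unfolding grad_def dot_sum dot_linear
  proof (rule sum.cong)
    fix e :: "3 \<times> 3"
    show "(\<Prod>e'\<in>UNIV - {e}. dot (side e') v) * dot (side e) v = (\<Prod>e\<in>UNIV. dot (side e) v)"
      by (subst prod.remove[of UNIV e]) (auto simp: mult.commute)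
  qed simp
  then show ?thesis by (simp add: card_sides)
qed

definition node :: "3 \<times> 3 \<Rightarrow> 3 \<times> 3 \<Rightarrow> complex^3" where
  "node e e' = cross (side e) (side e')"

lemma two_sides_parallel:
  assumes "dot (side e) u = 0" "dot (side e) v = 0" "dot (side e') u = 0" "dot (side e') v = 0" "e \<noteq> e'" "u \<noteq> 0"
  shows "cross u v = 0"
proof -
  have par: "\<exists>c. node e e' = c *s w" if "dot (side e) w = 0" "dot (side e') w = 0" "w \<noteq> 0" for w
  proof -
    have "cross w (node e e') = 0" using that by (simp add: node_def triple_cross dot_commute)
    then show ?thesis using cross_eq_0_iff[OF that(3)] by blast
  qed
  show ?thesis
  proof (cases "v = 0")
    case False
    obtain c d where "node e e' = c *s u" "node e e' = d *s v" using par assms False by metis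
    moreover have "node e e' \<noteq> 0" using side_distinct[OF assms(5)] by (simp add: node_def)
    ultimately have "d *s cross u v = 0" "d \<noteq> 0" by (metis cross_linear(3) cross_self vec.scale_zero_right, auto)
    then show ?thesis by simp
  qed (simp add: cross_linear)
qed

text \<open>
  A third line would make the point a triple point, and the three lines would share a vertex.
\<close>

lemma node_on_third_side:
  assumes "dot (side e'') (node e e') = 0" "fst e \<noteq> fst e'" "snd e \<noteq> snd e'"
  shows "e'' = e \<or> e'' = e'"
proof (rule ccontr)
  assume "\<not> ?thesis"
  then have d: "distinct [(fst e, snd e), (fst e', snd e'), (fst e'', snd e'')]"
    using assms(2) by auto
  have "bracket (side e) (side e') (side e'') = 0"
    using assms(1) by (simp add: bracket_def node_def dot_commute)
  then show False
    using concurrent_imp_vertex[OF d] assms(2,3) by (simp add: side_def)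
qed

text \<open>
  The line \<open>(i, j)\<close> passes through its two vertices, each of which absorbs two further lines, and
  meets the remaining four lines in double points. These are distinct: for any two of them, some other
  line passes through the first and not through the second.
\<close>

lemma six_points_on_side:
  obtains S where "finite S" "card S = 6" "\<And>s. s \<in> S \<Longrightarrow> s \<noteq> 0 \<and> dot (side e) s = 0 \<and> (\<exists>e'. e' \<noteq> e \<and> dot (side e') s = 0)"
    "\<And>s s'. s \<in> S \<Longrightarrow> s' \<in> S \<Longrightarrow> s \<noteq> s' \<Longrightarrow> cross s s' \<noteq> 0"
proof -
  obtain i j where e: "e = (i, j)" by force
  define T where "T = (UNIV - {i}) \<times> (UNIV - {j})"
  \<comment> \<open>\<open>Inl\<close> marks the double points, \<open>Inr\<close> the two vertices\<close>
  define pt where "pt x = (case x of Inl e' \<Rightarrow> node e e' | Inr b \<Rightarrow> if b then p i else q j)" for x :: "3 \<times> 3 + bool"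
  let ?X = "Inl ` T \<union> {Inr True, Inr False}"
  have T: "e' \<in> T \<longleftrightarrow> i \<noteq> fst e' \<and> j \<noteq> snd e'" for e' by (cases e') (auto simp: T_def)
  have cT: "card T = 4" by (simp add: T_def card_cartesian_product)
  have nz: "pt x \<noteq> 0" if "x \<in> ?X" for x
    using that side_distinct p_nonzero q_nonzero by (auto simp: pt_def T e node_def)
  have on: "dot (side e) (pt x) = 0" if "x \<in> ?X" for x
    using that by (auto simp: pt_def e vertex_on_side node_def dot_commute[of "side (i,j)" "cross _ _"])
  have third: "\<exists>e'. e' \<noteq> e \<and> dot (side e') (pt x) = 0 \<and> dot (side e') (pt y) \<noteq> 0" if "x \<in> ?X" "y \<in> ?X" "x \<noteq> y" for x y
  proof -
    have "\<exists>k::3. k \<noteq> i" for i by (metis zero_neq_one)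
    then obtain j' i' where ij: "j' \<noteq> j" "i' \<noteq> i" by blast
    from that(1) consider (node) e' where "x = Inl e'" "e' \<in> T" | (p) "x = Inr True" | (q) "x = Inr False" by blast
    then show ?thesis
    proof cases
      case node
      then have "e' \<noteq> e" using T e by auto
      with node show ?thesis using that(2,3) node_on_third_side[of e' e] T e
        by (intro exI[of _ e']) (auto simp: pt_def side_through_p_iff side_through_q_iff node_def dot_commute[of "side e'" "cross _ _"])
    next
      case p
      then show ?thesis using that(2,3) node_on_third_side[of "(i,j')" e] T e ij
        by (intro exI[of _ "(i, j')"]) (auto simp: pt_def side_through_p_iff side_through_q_iff)
    next
      case q
      then show ?thesis using that(2,3) node_on_third_side[of "(i',j)" e] T e ij
        by (intro exI[of _ "(i', j)"]) (auto simp: pt_def side_through_p_iff side_through_q_iff)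
    qed
  qed
  have cross: "cross (pt x) (pt y) \<noteq> 0" if xy: "x \<in> ?X" "y \<in> ?X" "x \<noteq> y" for x y
  proof
    assume "cross (pt x) (pt y) = 0"
    then obtain c where "pt y = c *s pt x" using cross_eq_0_iff[OF nz[OF xy(1)]] by blast
    moreover obtain e' where "dot (side e') (pt x) = 0" "dot (side e') (pt y) \<noteq> 0"
      using third[OF xy] by blast
    ultimately show False by (simp add: dot_linear)
  qed
  have inj: "inj_on pt ?X" using cross by (intro inj_onI) (metis cross_self)
  show ?thesis
  proof (rule that[of "pt ` ?X"])
    have "card ?X = 6" using cT by (subst card_Un_disjoint) (auto simp: card_image T_def)
    then show "card (pt ` ?X) = 6" by (simp only: card_image[OF inj])
    show "finite (pt ` ?X)" by (simp add: T_def)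
    fix s assume "s \<in> pt ` ?X"
    then obtain x where x: "x \<in> ?X" "s = pt x" by blast
    obtain y where y: "y \<in> ?X" "x \<noteq> y" by blast
    show "s \<noteq> 0 \<and> dot (side e) s = 0 \<and> (\<exists>e'. e' \<noteq> e \<and> dot (side e') s = 0)"
      using nz[OF x(1)] on[OF x(1)] third[OF x(1) y] x(2) by auto
  next
    fix s s' assume "s \<in> pt ` ?X" "s' \<in> pt ` ?X" "s \<noteq> s'"
    then show "cross s s' \<noteq> 0" using cross by blast
  qed
qed

text \<open>
  Tangency to the lines comes from \<open>grad\<close> being a nonzero multiple of the covector \<open>side e\<close> at
  general points of a line. At a crossing, \<open>\<delta>\<close> is tangent to two lines, hence parallel to the
  position vector. The degree bound is sharp for the count: six zeros force a form of degree
  \<open>k + 1\<close> on a projective line to vanish only if \<open>k + 1 < 6\<close>.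
\<close>

theorem no_syzygy_below_5:
  assumes \<delta>: "\<And>i. form k (\<lambda>v. \<delta> v $ i)" and k: "k < 5"
    and syz: "\<And>v. dot (grad v) (\<delta> v) = 0"
  shows "\<delta> v = 0"
proof -
  have log: "dot (side e) (\<delta> v) = 0" if "dot (side e) v = 0" for e v
  proof (rule form_zero_on_side[OF form_dot_component[OF \<delta>] _ that])
    fix v assume v: "dot (side e) v = 0" "\<forall>e'\<in>UNIV - {e}. dot (side e') v \<noteq> 0"
    have "(\<Prod>e'\<in>UNIV - {e}. dot (side e') v) * dot (side e) (\<delta> v) = 0"
      using syz[of v] by (simp add: grad_on_side[OF v(1)] dot_linear)
    then show "dot (side e) (\<delta> v) = 0" using v(2) by simp
  qed
  have sing: "cross s (\<delta> s) = 0" if "s \<noteq> 0" "dot (side e) s = 0" "dot (side e') s = 0" "e \<noteq> e'" for e e' s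
    using two_sides_parallel[of e s "\<delta> s" e'] that log by auto
  have on_side: "cross v (\<delta> v) $ i = 0" if v: "dot (side e) v = 0" for e v i
  proof -
    obtain S where S: "finite S" "card S = 6" "\<And>s. s \<in> S \<Longrightarrow> s \<noteq> 0 \<and> dot (side e) s = 0 \<and> (\<exists>e'. e' \<noteq> e \<and> dot (side e') s = 0)"
      "\<And>s s'. s \<in> S \<Longrightarrow> s' \<in> S \<Longrightarrow> s \<noteq> s' \<Longrightarrow> cross s s' \<noteq> 0"
      by (rule six_points_on_side) blast
    have z: "cross s (\<delta> s) $ i = 0" if "s \<in> S" for s
      using S(3)[OF that] sing by (metis zero_index)
    show ?thesis
      by (rule form_zero_if_many_zeros_on_line[OF form_cross_component[OF \<delta>], of S "side e"])
         (use S z v k side_nonzero in auto)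
  qed
  have "cross v (\<delta> v) $ i = 0" for v i
    by (rule form_zero_if_zero_on_sides[OF form_cross_component[OF \<delta>]]) (use k on_side in auto)
  then have "cross v (\<delta> v) = 0" for v by (simp add: vec_eq_iff)
  then have *: "(\<Prod>e\<in>UNIV. dot (side e) v) *s \<delta> v = 0" for v
    using triple_cross[of "grad v" v "\<delta> v"] by (simp add: syz euler cross_linear)
  have "\<delta> v $ i = 0" for v i
  proof (rule form_zero_off_sides[OF \<delta>])
    fix v assume "\<forall>e. dot (side e) v \<noteq> 0"
    then have "(\<Prod>e\<in>UNIV. dot (side e) v) \<noteq> 0" by simp
    then show "\<delta> v $ i = 0" using *[of v] by simp
  qed
  then show ?thesis by (simp add: vec_eq_iff)
qed

end

section \<open>The syzygy of degree five defined by a stress\<close>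

lemma exhaust_distinct_3:
  fixes i i' :: 3
  assumes "i \<noteq> i'"
  obtains i'' where "i'' \<noteq> i" "i'' \<noteq> i'" "UNIV = {i, i', i''}"
proof -
  have "card (UNIV - {i, i'}) = 1"
    using assms by (simp add: card_Diff_subset)
  then obtain i'' where "UNIV - {i, i'} = {i''}" by (auto simp: card_1_singleton_iff)
  then show ?thesis by (intro that[of i'']) auto
qed

text \<open>
  In the language of rigidity, \<open>\<omega> i j\<close> is the force density along the bar joining \<open>p i\<close> to \<open>q j\<close>,
  and the equations are the balance of forces at the six joints, in projective form.
\<close>

definition equilibrium_stress :: "(3 \<Rightarrow> complex^3) \<Rightarrow> (3 \<Rightarrow> complex^3) \<Rightarrow> (3 \<Rightarrow> 3 \<Rightarrow> complex) \<Rightarrow> bool" where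
  "equilibrium_stress p q \<omega> \<longleftrightarrow>
     (\<forall>i. (\<Sum>j\<in>UNIV. \<omega> i j *s cross (p i) (q j)) = 0) \<and> (\<forall>j. (\<Sum>i\<in>UNIV. \<omega> i j *s cross (p i) (q j)) = 0)"

context k33_arrangement
begin

text \<open>
  A 4-cycle of the graph is a quadrilateral of lines with two further intersections of opposite sides.
  The diagonal is the line joining these two points.
\<close>

definition diagonal :: "3 \<Rightarrow> 3 \<Rightarrow> 3 \<Rightarrow> 3 \<Rightarrow> complex^3" where
  "diagonal i i' j j' = cross (node (i, j) (i', j')) (node (i, j') (i', j))"

text \<open>
  Exchanging the two odd or the two even vertices of the cycle reverses the orientation. The signs
  will cancel the contributions of neighbouring cycles.
\<close>

lemma diagonal_antisym:
  "diagonal i' i j j' = - diagonal i i' j j'" "diagonal i i' j' j = - diagonal i i' j j'"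
proof -
  have "diagonal i' i j j' = cross (- node (i, j') (i', j)) (- node (i, j) (i', j'))"
    unfolding diagonal_def node_def using cross_skew by metis
  then show "diagonal i' i j j' = - diagonal i i' j j'"
    by (simp add: cross_linear diagonal_def cross_skew[of "node (i, j') (i', j)"])
  show "diagonal i i' j' j = - diagonal i i' j j'"
    by (simp add: diagonal_def cross_skew[of "node (i, j') (i', j)"])
qed

lemma dot_side: "dot (side (i, j)) v = bracket (p i) (q j) v"
  by (simp add: side_def bracket_def)

text \<open>
  On a side of the quadrilateral, both the diagonal and the opposite side vanish at the same point, so
  they are proportional; only the factor has to be computed.
\<close>

lemma diagonal_on_side:
  assumes "v = x *s p i + y *s q j"
  shows "dot (diagonal i i' j j') v = - dot (side (i, j')) (q j) * dot (side (i', j)) (p i) * dot (side (i', j')) v"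
proof -
  define a b c d where "a = bracket (p i) (q j) (q j')" and "b = bracket (p i) (q j) (p i')"
    and "c = bracket (p i) (q j') (p i')" and "d = bracket (p i') (q j) (q j')"
  have s: "node (i, j) (i', j') = a *s p i' - b *s q j'"
    by (simp add: node_def side_def cross_cross a_def b_def)
  have s': "node (i, j') (i', j) = - a *s p i' - c *s q j"
    by (simp add: node_def side_def cross_cross c_def a_def bracket_permute(4)[of "p i" "q j'" "q j"])
  have "diagonal i i' j j' = - (a * c) *s cross (p i') (q j) + (a * b) *s cross (q j') (p i') + (b * c) *s cross (q j') (q j)"
    unfolding diagonal_def s s' by (simp add: vec3_eq_iff algebra_simps)
  then have dv: "dot (diagonal i i' j j') v = - (a * c) * bracket (p i') (q j) v + (a * b) * bracket (q j') (p i') v + (b * c) * bracket (q j') (q j) v" for v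
    by (simp add: dot_linear bracket_def)
  have "bracket (p i') (q j) (p i) = - b" "bracket (q j') (p i') (p i) = c" "bracket (q j') (q j) (p i) = - a"
    "bracket (q j') (p i') (q j) = d"
    "bracket (p i) (q j') (q j) = - a" "bracket (p i') (q j') (p i) = - c" "bracket (p i') (q j') (q j) = - d"
    unfolding a_def b_def c_def d_def bracket_def dot_def by (simp_all add: algebra_simps)
  note e = this
  have "dot (diagonal i i' j j') (p i) = a * b * c" "dot (diagonal i i' j j') (q j) = a * b * d"
    unfolding dv by (simp_all add: e)
  then show ?thesis
    by (simp add: assms dot_linear dot_side e algebra_simps)
qed

text \<open>
  The product of the diagonal and the five lines outside the cycle. It vanishes on those five, and on
  the four lines of the cycle it vanishes at all six singular points.
\<close>

definition cycle_sextic :: "3 \<Rightarrow> 3 \<Rightarrow> 3 \<Rightarrow> 3 \<Rightarrow> complex^3 \<Rightarrow> complex" where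
  "cycle_sextic i i' j j' v = dot (diagonal i i' j j') v * (\<Prod>e\<in>UNIV - {i, i'} \<times> {j, j'}. dot (side e) v)"

lemma cycle_sextic_antisym:
  "cycle_sextic i' i j j' v = - cycle_sextic i i' j j' v" "cycle_sextic i i' j' j v = - cycle_sextic i i' j j' v"
  unfolding cycle_sextic_def
  by (simp_all add: diagonal_antisym[of i' i] diagonal_antisym(2)[of i i' j' j] dot_linear insert_commute)

lemma form_cycle_sextic:
  assumes "i \<noteq> i'" "j \<noteq> j'"
  shows "form 6 (cycle_sextic i i' j j')"
proof -
  have "card (UNIV - {i, i'} \<times> {j, j'}) = 5"
    using assms by (subst card_Diff_subset) (auto simp: card_sides card_cartesian_product)
  then show ?thesis
    using form.dot_mult[OF form_prod_dot[of "UNIV - {i, i'} \<times> {j, j'}" side], of "diagonal i i' j j'"]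
    by (simp add: cycle_sextic_def[abs_def])
qed

text \<open>
  On the line with parameters \<open>x, y\<close>, this is up to a constant the binary sextic with zeros at the six
  singular points: \<open>x\<close> and \<open>y\<close> vanish at the vertices, the last product at the four double points.
  The constant is chosen to make the next lemma free of the cycle.
\<close>

definition side_sextic :: "3 \<Rightarrow> 3 \<Rightarrow> complex \<Rightarrow> complex \<Rightarrow> complex^3 \<Rightarrow> complex" where
  "side_sextic i j x y v = - x * y * (\<Prod>j'\<in>UNIV - {j}. dot (side (i, j')) (q j)) * (\<Prod>i'\<in>UNIV - {i}. dot (side (i', j)) (p i))
     * (\<Prod>e\<in>(UNIV - {i}) \<times> (UNIV - {j}). dot (side e) v)"

text \<open>
  The right-hand side does not mention \<open>i'\<close> and \<open>j'\<close>: all four cycles through a line induce the same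
  sextic on it. This is what allows the coefficients of different cycles to be added line by line.
\<close>

lemma cycle_sextic_on_side:
  assumes v: "v = x *s p i + y *s q j" and ij: "i \<noteq> i'" "j \<noteq> j'"
  shows "cycle_sextic i i' j j' v = side_sextic i j x y v"
proof -
  obtain i'' where i: "i'' \<noteq> i" "i'' \<noteq> i'" "UNIV = {i, i', i''}" using exhaust_distinct_3[OF ij(1)] by blast
  obtain j'' where j: "j'' \<noteq> j" "j'' \<noteq> j'" "UNIV = {j, j', j''}" using exhaust_distinct_3[OF ij(2)] by blast
  have I: "UNIV - {i} = {i', i''}" and J: "UNIV - {j} = {j', j''}" using i j ij by auto
  have "a \<notin> {i, i'} \<longleftrightarrow> a = i''" "b \<notin> {j, j'} \<longleftrightarrow> b = j''" for a b using i j by auto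
  then have "x \<in> UNIV - {i, i'} \<times> {j, j'} \<longleftrightarrow> x \<in> {i''} \<times> UNIV \<union> {i, i'} \<times> {j''}" for x
    unfolding Diff_iff Un_iff mem_Times_iff singleton_iff by (metis UNIV_I)
  then have "UNIV - {i, i'} \<times> {j, j'} = {i''} \<times> UNIV \<union> {i, i'} \<times> {j''}" by (rule set_eqI)
  also have "\<dots> = {i''} \<times> {j, j', j''} \<union> {i, i'} \<times> {j''}" unfolding j(3) ..
  finally have R: "UNIV - {i, i'} \<times> {j, j'} = {(i, j''), (i'', j), (i'', j'), (i', j''), (i'', j'')}"
    by (simp add: insert_commute)
  have on: "dot (side (i, j'')) v = y * dot (side (i, j'')) (q j)" "dot (side (i'', j)) v = x * dot (side (i'', j)) (p i)"
    by (simp_all add: v dot_linear vertex_on_side)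
  show ?thesis
    unfolding cycle_sextic_def side_sextic_def R I J diagonal_on_side[OF v]
    using i j ij by (simp add: on Sigma_def algebra_simps)
qed

lemma cycle_sextic_off_cycle:
  assumes "dot (side e) v = 0" "e \<notin> {i, i'} \<times> {j, j'}"
  shows "cycle_sextic i i' j j' v = 0"
proof -
  have "(\<Prod>e\<in>UNIV - {i, i'} \<times> {j, j'}. dot (side e) v) = 0"
    by (rule prod_zero) (use assms in auto)
  then show ?thesis by (simp add: cycle_sextic_def)
qed

lemma point_on_side:
  assumes "dot (side (i, j)) v = 0"
  shows "\<exists>x y. v = x *s p i + y *s q j"
proof -
  obtain w where w: "dot (side (i, j)) w \<noteq> 0" using dot_nondegenerate side_nonzero by blast
  define d where "d = bracket (p i) (q j) w"
  have d: "d \<noteq> 0" using w by (simp add: d_def dot_side)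
  have "bracket (p i) (q j) w *s v = bracket v (q j) w *s p i + bracket (p i) v w *s q j + bracket (p i) (q j) v *s w"
    by (rule bracket_expand)
  then have e: "d *s v = bracket v (q j) w *s p i + bracket (p i) v w *s q j" using assms
    by (simp add: dot_side d_def)
  have "v = (1 / d) *s (d *s v)" using d by simp
  then have "v = (bracket v (q j) w / d) *s p i + (bracket (p i) v w / d) *s q j"
    unfolding e by (simp add: vec.scale_right_distrib)
  then show ?thesis by blast
qed

abbreviation stress :: "(3 \<Rightarrow> 3 \<Rightarrow> complex) \<Rightarrow> bool" where
  "stress \<equiv> equilibrium_stress p q"

lemma stress_iff:
  "stress \<omega> \<longleftrightarrow> (\<forall>i. (\<Sum>j\<in>UNIV. \<omega> i j *s side (i, j)) = 0) \<and> (\<forall>j. (\<Sum>i\<in>UNIV. \<omega> i j *s side (i, j)) = 0)"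
  by (simp add: equilibrium_stress_def side_def)

text \<open>
  The 4-cycles through the edge \<open>(3, 3)\<close> form a basis for the matrices with vanishing row and column
  sums: the cycle for \<open>(i, j)\<close> contributes \<open>1\<close> at \<open>(i, j)\<close> and \<open>(3, 3)\<close>, and \<open>-1\<close> at \<open>(i, 3)\<close> and
  \<open>(3, j)\<close>. The covectors \<open>\<omega> i j *s side (i, j)\<close> of a stress form such a matrix, so prescribing its
  four entries with \<open>i, j \<in> {1, 2}\<close> determines the others.
\<close>

definition stress_field :: "(3 \<Rightarrow> 3 \<Rightarrow> complex) \<Rightarrow> complex^3 \<Rightarrow> complex^3" where
  "stress_field \<omega> v = (\<Sum>i\<in>{1, 2}. \<Sum>j\<in>{1, 2}. (\<omega> i j * cycle_sextic i 3 j 3 v) *s side (i, j))"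

lemma form_stress_field: "form 6 (\<lambda>v. stress_field \<omega> v $ i)"
proof -
  have "form 6 (\<lambda>v. (\<omega> a b * side (a, b) $ i) * cycle_sextic a 3 b 3 v)" if "a \<noteq> 3" "b \<noteq> 3" for a b
    by (intro form_scale form_cycle_sextic that)
  then have "form 6 (\<lambda>v. \<Sum>a\<in>{1, 2}. \<Sum>b\<in>{1, 2}. (\<omega> a b * side (a, b) $ i) * cycle_sextic a 3 b 3 v)"
    by (intro form_sum) auto
  moreover have "(\<lambda>v. stress_field \<omega> v $ i) = (\<lambda>v. \<Sum>a\<in>{1, 2}. \<Sum>b\<in>{1, 2}. (\<omega> a b * side (a, b) $ i) * cycle_sextic a 3 b 3 v)"
    by (rule ext) (simp add: stress_field_def algebra_simps)
  ultimately show ?thesis by simp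
qed

lemma stress_field_on_side:
  assumes "stress \<omega>" and v: "v = x *s p i + y *s q j"
  shows "stress_field \<omega> v = (side_sextic i j x y v * \<omega> i j) *s side (i, j)"
proof -
  have on: "dot (side (i, j)) v = 0" by (simp add: v dot_linear vertex_on_side)
  define K where "K = side_sextic i j x y v"
  have F: "cycle_sextic a 3 b 3 v = (if i = a \<and> j = b \<or> i = 3 \<and> j = 3 then K
      else if i = a \<and> j = 3 \<or> i = 3 \<and> j = b then - K else 0)" if "a \<noteq> 3" "b \<noteq> 3" for a b
  proof -
    consider "i = a" "j = b" | "i = 3" "j = 3" | "i = a" "j = 3" | "i = 3" "j = b" | "(i, j) \<notin> {a, 3} \<times> {b, 3}" by auto
    then show ?thesis
    proof cases
      case 1 then show ?thesis using cycle_sextic_on_side[OF v, of 3 3] that by (simp add: K_def)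
    next
      case 2 then show ?thesis using cycle_sextic_on_side[OF v, of a b] that
        by (simp add: K_def cycle_sextic_antisym(1)[of a 3] cycle_sextic_antisym(2)[of 3 a b 3])
    next
      case 3 then show ?thesis using cycle_sextic_on_side[OF v, of 3 b] that
        by (simp add: K_def cycle_sextic_antisym(2)[of a 3 b 3])
    next
      case 4 then show ?thesis using cycle_sextic_on_side[OF v, of a 3] that
        by (simp add: K_def cycle_sextic_antisym(1)[of a 3])
    next
      case 5 then show ?thesis using cycle_sextic_off_cycle[OF on] by auto
    qed
  qed
  define s where "s i j = \<omega> i j *s side (i, j)" for i j
  have row: "s i 1 + s i 2 + s i 3 = 0" and col: "s 1 j + s 2 j + s 3 j = 0" for i j
    using assms(1) by (simp_all add: stress_iff s_def sum_3)
  have r3: "s i 3 = - (s i 1 + s i 2)" "s 3 j = - (s 1 j + s 2 j)" for i j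
    using row[of i] col[of j] by (simp_all add: add_eq_0_iff add.commute)
  have "stress_field \<omega> v = (\<Sum>a\<in>{1, 2}. \<Sum>b\<in>{1, 2}. cycle_sextic a 3 b 3 v *s s a b)"
    by (simp add: stress_field_def s_def mult.commute)
  also have "\<dots> = K *s s i j"
    using exhaust_3[of i] exhaust_3[of j]
    by (elim disjE) (simp_all add: F r3 vec3_eq_iff algebra_simps)
  finally show ?thesis by (simp add: K_def s_def)
qed

lemma form_grad: "form 8 (\<lambda>v. grad v $ i)"
proof -
  have "form 8 (\<lambda>v. \<Sum>e\<in>UNIV. side e $ i * (\<Prod>e'\<in>UNIV - {e}. dot (side e') v))"
  proof (intro form_sum form_scale)
    fix e :: "3 \<times> 3"
    have "card (UNIV - {e}) = 8" by (simp add: card_Diff_singleton card_sides)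
    then show "form 8 (\<lambda>v. \<Prod>e'\<in>UNIV - {e}. dot (side e') v)"
      using form_prod_dot[of "UNIV - {e}" side] by simp
  qed
  moreover have "(\<lambda>v. grad v $ i) = (\<lambda>v. \<Sum>e\<in>UNIV. side e $ i * (\<Prod>e'\<in>UNIV - {e}. dot (side e') v))"
    by (rule ext) (simp add: grad_def sum_component mult.commute)
  ultimately show ?thesis by simp
qed

text \<open>
  Write \<open>f\<close> for the product of the nine linear forms and \<open>W\<close> for the field of the stress. By the product
  rule, \<open>grad f \<times> W\<close> is the sum over the lines of \<open>(f / n\<^sub>e) (n\<^sub>e \<times> W)\<close>, and \<open>n\<^sub>e\<close> divides \<open>n\<^sub>e \<times> W\<close>
  because \<open>W\<close> is parallel to \<open>n\<^sub>e\<close> on the line. The quotient \<open>\<delta>\<close> of \<open>grad f \<times> W\<close> by \<open>f\<close> is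
  orthogonal to \<open>grad f\<close>. If it were zero, \<open>W\<close> would be parallel to \<open>grad f\<close>; but \<open>W\<close> is
  orthogonal to \<open>v\<close>, while \<open>grad f\<close> is not where \<open>f\<close> is nonzero, by Euler's formula.
\<close>

theorem syzygy_of_stress:
  assumes \<omega>: "stress \<omega>" "\<omega> i0 j0 \<noteq> 0"
  shows "\<exists>\<delta>. (\<forall>i. form 5 (\<lambda>v. \<delta> v $ i)) \<and> (\<exists>v. \<delta> v \<noteq> 0) \<and> (\<forall>v. dot (grad v) (\<delta> v) = 0)"
proof -
  let ?W = "stress_field \<omega>"
  let ?f = "\<lambda>v. \<Prod>e\<in>UNIV. dot (side e) v"
  have on_side: "\<exists>c. ?W v = c *s side e" if "dot (side e) v = 0" for e v
    using stress_field_on_side[OF \<omega>(1)] point_on_side that by (metis prod.collapse)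
  have "\<exists>h. form 5 h \<and> (\<forall>v. cross (side e) (?W v) $ i = dot (side e) v * h v)" for e i
  proof (rule form_divisible)
    have "form 6 (\<lambda>v. a * ?W v $ k - b * ?W v $ l)" for a b k l
      by (intro form_diff form_scale form_stress_field)
    then show "form (Suc 5) (\<lambda>v. cross (side e) (?W v) $ i)"
      using exhaust_3[of i] by auto
    show "cross (side e) (?W v) $ i = 0" if "dot (side e) v = 0" for v
      using on_side[OF that] by (auto simp: cross_linear)
  qed (rule side_nonzero)
  then obtain h where h: "\<And>e i. form 5 (h e i)" "\<And>e i v. cross (side e) (?W v) $ i = dot (side e) v * h e i v"
    by metis
  define \<delta> where "\<delta> v = (\<chi> i. \<Sum>e\<in>UNIV. h e i v)" for v
  have form: "form 5 (\<lambda>v. \<delta> v $ i)" for i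
    unfolding \<delta>_def using h(1) by (simp add: form_sum)
  have gW: "cross (grad v) (?W v) = ?f v *s \<delta> v" for v
  proof -
    have "cross (grad v) (?W v) $ i = ?f v * \<delta> v $ i" for i
    proof -
      have "cross (grad v) (?W v) $ i = (\<Sum>e\<in>UNIV. (\<Prod>e'\<in>UNIV - {e}. dot (side e') v) * (dot (side e) v * h e i v))"
        unfolding grad_def cross_sum cross_linear sum_component vector_smult_component h(2) ..
      also have "\<dots> = (\<Sum>e\<in>UNIV. ?f v * h e i v)"
      proof (rule sum.cong)
        fix e :: "3 \<times> 3"
        show "(\<Prod>e'\<in>UNIV - {e}. dot (side e') v) * (dot (side e) v * h e i v) = ?f v * h e i v"
          by (simp add: prod.remove[of UNIV e "\<lambda>e. dot (side e) v"])
      qed simp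
      finally show ?thesis by (simp add: \<delta>_def sum_distrib_left)
    qed
    then show ?thesis by (simp add: vec_eq_iff)
  qed
  have syz: "dot (grad v) (\<delta> v) = 0" for v
  proof (rule form_zero_off_sides[where g = "\<lambda>v. dot (grad v) (\<delta> v)"])
    show "form (8 + 5) (\<lambda>v. dot (grad v) (\<delta> v))"
      unfolding dot_def by (intro form.add form_mult form_grad form)
    fix v assume "\<forall>e. dot (side e) v \<noteq> 0"
    then have "?f v \<noteq> 0" by simp
    moreover have "?f v * dot (grad v) (\<delta> v) = 0"
      using arg_cong[OF gW[of v], of "dot (grad v)"] by (simp add: dot_linear dot_commute[of "grad v"])
    ultimately show "dot (grad v) (\<delta> v) = 0" by simp
  qed
  have vW: "dot v (?W v) = 0" for v
  proof (rule form_zero_if_zero_on_sides[where g = "\<lambda>v. dot v (?W v)"])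
    \<comment> \<open>degree 7, and zero on nine lines\<close>
    show "form (1 + 6) (\<lambda>v. dot v (?W v))"
      unfolding dot_def by (intro form.add form_mult form_nth form_stress_field)
    show "dot v (?W v) = 0" if "dot (side e) v = 0" for e v
      using on_side[OF that] that by (auto simp: dot_linear dot_commute[of v])
  qed simp
  have "\<exists>v. \<delta> v \<noteq> 0"
  proof (rule ccontr)
    assume "\<not> ?thesis"
    then have 0: "9 * ?f v = 0 \<or> ?W v = 0" for v
      using triple_cross[of v "grad v" "?W v"] gW[of v]
      by (simp add: vW cross_linear dot_commute[of v] euler)
    have W: "?W v $ i = 0" for v i
    proof (rule form_zero_off_sides[OF form_stress_field])
      fix v assume "\<forall>e. dot (side e) v \<noteq> 0"
      then have "?f v \<noteq> 0" by simp
      then show "?W v $ i = 0" using 0[of v] by simp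
    qed
    \<comment> \<open>at a general point of a line with nonzero weight, the field does not vanish\<close>
    obtain v where v: "dot (side (i0, j0)) v = 0" "\<forall>e'\<in>UNIV - {(i0, j0)}. dot (side e') v \<noteq> 0"
      using on_side_off_others[of "(i0, j0)" 0] by (auto simp: dot_linear)
    obtain x y where xy: "v = x *s p i0 + y *s q j0" using point_on_side v(1) by blast
    obtain i' j' where "i' \<noteq> i0" "j' \<noteq> j0" by (metis zero_neq_one)
    then have "dot (side (i', j0)) v \<noteq> 0" "dot (side (i0, j')) v \<noteq> 0" using v(2) by auto
    then have "x \<noteq> 0" "y \<noteq> 0" by (auto simp: xy dot_linear vertex_on_side)
    then have "side_sextic i0 j0 x y v \<noteq> 0"
      using v(2) by (auto simp: side_sextic_def side_through_p_iff side_through_q_iff)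
    then have "?W v \<noteq> 0" using stress_field_on_side[OF \<omega>(1) xy] \<omega>(2) side_nonzero by simp
    then show False using W by (simp add: vec_eq_iff)
  qed
  then show ?thesis using form syz by blast
qed

end

section \<open>A conic through the six points gives a stress\<close>

lemma index_3_wraps: "(4 :: 3) = 1" "(5 :: 3) = 2"
  by simp_all

text \<open>
  The degree two monomials: the squares, and for each coordinate the product of the other two. The
  index arithmetic is modulo \<open>3\<close>.
\<close>

definition veronese :: "complex^3 \<Rightarrow> complex^(3 + 3)" where
  "veronese v = (\<chi> d. case d of Inl r \<Rightarrow> (v $ r)^2 | Inr r \<Rightarrow> v $ (r + 1) * v $ (r + 2))"

lemma sum_UNIV_plus: "(\<Sum>d\<in>(UNIV :: ('a::finite + 'b::finite) set). f d) = (\<Sum>a\<in>UNIV. f (Inl a)) + (\<Sum>b\<in>UNIV. f (Inr b))"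
  using sum.Plus[of UNIV UNIV f] by simp

lemma form_2_veronese: "form 2 g \<Longrightarrow> \<exists>c. \<forall>v. g v = (\<Sum>d\<in>UNIV. veronese v $ d * c $ d)"
proof -
  have "k = 2 \<Longrightarrow> \<exists>c. \<forall>v. g v = (\<Sum>d\<in>UNIV. veronese v $ d * c $ d)" if "form k g" for k g
    using that
  proof (induction rule: form.induct)
    case (zero k)
    show ?case by (rule exI[of _ 0]) simp
  next
    case (dot_mult k g n)
    then have "form 1 g" by (simp add: numeral_2_eq_2)
    then obtain m where m: "g = dot m" using form_1_imp_dot by blast
    show ?case
      by (rule exI[of _ "\<chi> d. case d of Inl r \<Rightarrow> n $ r * m $ r | Inr r \<Rightarrow> n $ (r + 1) * m $ (r + 2) + n $ (r + 2) * m $ (r + 1)"])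
         (simp add: sum_UNIV_plus sum_3 m dot_def veronese_def index_3_wraps algebra_simps power2_eq_square)
  next
    case (add k g h)
    then obtain c d where "\<forall>v. g v = (\<Sum>e\<in>UNIV. veronese v $ e * c $ e)" "\<forall>v. h v = (\<Sum>e\<in>UNIV. veronese v $ e * d $ e)"
      by blast
    then show ?case by (intro exI[of _ "c + d"]) (simp add: sum.distrib distrib_left)
  qed simp
  then show "form 2 g \<Longrightarrow> \<exists>c. \<forall>v. g v = (\<Sum>d\<in>UNIV. veronese v $ d * c $ d)" by blast
qed

text \<open>
  The Veronese images of six points on a conic are the rows of a square matrix that kills the
  coefficient vector of the conic, so these rows are dependent. The dependency is stated contracted
  with a covector \<open>n\<close>, the form in which it is applied.
\<close>

lemma conic_dependency:
  fixes a :: "3 + 3 \<Rightarrow> complex^3"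
  assumes g: "form 2 g" "g v \<noteq> 0" and z: "\<And>k. g (a k) = 0"
  obtains \<eta> where "\<exists>k. \<eta> k \<noteq> 0" "\<And>n. (\<Sum>k\<in>UNIV. (\<eta> k * dot n (a k)) *s a k) = 0"
proof -
  obtain c where c: "\<And>v. g v = (\<Sum>d\<in>UNIV. veronese v $ d * c $ d)" using form_2_veronese[OF g(1)] by blast
  define M where "M = (\<chi> k. veronese (a k))"
  have "M *v c = 0" by (simp add: M_def matrix_vector_mult_def vec_eq_iff c[symmetric] z)
  moreover have "c \<noteq> 0" using g(2) c by auto
  ultimately have "\<not> (\<exists>B. M ** B = mat 1)"
    unfolding matrix_left_right_inverse matrix_left_invertible_ker by blast
  then obtain \<eta> where l: "(\<Sum>k\<in>UNIV. \<eta> k *s row k M) = 0" "\<exists>k. \<eta> k \<noteq> 0"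
    unfolding matrix_right_invertible_independent_rows by blast
  have V: "(\<Sum>k\<in>UNIV. \<eta> k * veronese (a k) $ d) = 0" for d
    using arg_cong[OF l(1), of "\<lambda>x. x $ d"] by (simp add: M_def row_def)
  have S: "(\<Sum>k\<in>UNIV. \<eta> k * (a k $ r * a k $ s)) = 0" for r s
    using V[of "Inl 1"] V[of "Inl 2"] V[of "Inl 3"] V[of "Inr 1"] V[of "Inr 2"] V[of "Inr 3"] exhaust_3[of r] exhaust_3[of s]
    by (elim disjE) (simp_all add: veronese_def index_3_wraps power2_eq_square mult.commute)
  have "(\<Sum>k\<in>UNIV. (\<eta> k * dot n (a k)) *s a k) = 0" for n
  proof -
    have "(\<Sum>k\<in>UNIV. \<eta> k * dot n (a k) * a k $ s) = 0" for s
    proof -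
      have "(\<Sum>k\<in>UNIV. \<eta> k * dot n (a k) * a k $ s) = n $ 1 * (\<Sum>k\<in>UNIV. \<eta> k * (a k $ 1 * a k $ s))
        + n $ 2 * (\<Sum>k\<in>UNIV. \<eta> k * (a k $ 2 * a k $ s)) + n $ 3 * (\<Sum>k\<in>UNIV. \<eta> k * (a k $ 3 * a k $ s))"
        unfolding sum_distrib_left sum.distrib[symmetric] by (rule sum.cong) (simp_all add: dot_def algebra_simps)
      then show ?thesis by (simp add: S)
    qed
    then show ?thesis by (simp add: vec_eq_iff)
  qed
  then show ?thesis using that l(2) by blast
qed

text \<open>
  Let \<open>c i\<close> be the basis dual to \<open>p\<close>, up to the factor \<open>D\<close>, and \<open>\<omega> i j = \<beta> j * dot (c i) (q j)\<close>.
  Balance at \<open>q j\<close> is the expansion of \<open>q j\<close> in the basis \<open>p\<close>; balance at \<open>p i\<close> is the dependency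
  contracted with \<open>c i\<close>, in which only the multiple of \<open>p i\<close> survives on the other side.
\<close>

lemma stress_if_independent:
  assumes D: "bracket (p 1) (p 2) (p 3) \<noteq> 0" and q: "\<And>j. q j \<noteq> 0"
    and ab: "(\<exists>i. \<alpha> i \<noteq> 0) \<or> (\<exists>j. \<beta> j \<noteq> (0::complex))"
    and dep: "\<And>n. (\<Sum>i\<in>UNIV. (\<alpha> i * dot n (p i)) *s p i) + (\<Sum>j\<in>UNIV. (\<beta> j * dot n (q j)) *s q j) = 0"
  shows "\<exists>\<omega>. equilibrium_stress p q \<omega> \<and> (\<exists>i j. \<omega> i j \<noteq> 0)"
proof -
  define D where "D = bracket (p 1) (p 2) (p 3)"
  define c where "c i = (if i = 1 then cross (p 2) (p 3) else if i = 2 then cross (p 3) (p 1) else cross (p 1) (p 2))" for i :: 3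
  have cp: "dot (c i) (p k) = (if i = k then D else 0)" for i k
    using exhaust_3[of i] exhaust_3[of k]
    by (elim disjE) (simp_all add: c_def D_def dot_def bracket_def algebra_simps)
  have expand: "(\<Sum>i\<in>UNIV. dot (c i) v *s p i) = D *s v" for v
    using bracket_expand[of "p 1" "p 2" "p 3" v]
    by (simp add: sum_3 D_def c_def bracket_def dot_def vec3_eq_iff algebra_simps)
  define \<omega> where "\<omega> i j = \<beta> j * dot (c i) (q j)" for i j
  have "(\<Sum>j\<in>UNIV. \<omega> i j *s cross (p i) (q j)) = 0" for i
  proof -
    have "(\<Sum>k\<in>UNIV. (\<alpha> k * dot (c i) (p k)) *s p k) = (\<alpha> i * D) *s p i"
      by (simp add: cp if_distrib[of "\<lambda>x. _ * x"] if_distrib[of "\<lambda>x. x *s _"] cong: if_cong)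
    then have "(\<Sum>j\<in>UNIV. (\<beta> j * dot (c i) (q j)) *s q j) = - (\<alpha> i * D) *s p i"
      using dep[of "c i"] by (simp add: add_eq_0_iff)
    then have "cross (p i) (\<Sum>j\<in>UNIV. \<omega> i j *s q j) = 0" by (simp add: \<omega>_def cross_linear)
    then show ?thesis by (simp add: cross_sum cross_linear)
  qed
  moreover have "(\<Sum>i\<in>UNIV. \<omega> i j *s cross (p i) (q j)) = 0" for j
  proof -
    have "(\<Sum>i\<in>UNIV. \<omega> i j *s cross (p i) (q j)) = \<beta> j *s cross (\<Sum>i\<in>UNIV. dot (c i) (q j) *s p i) (q j)"
      by (simp add: \<omega>_def cross_sum cross_linear vec.scale_sum_right)
    then show ?thesis by (simp add: expand cross_linear)
  qed
  moreover have "\<exists>i j. \<omega> i j \<noteq> 0"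
  proof -
    obtain j where j: "\<beta> j \<noteq> 0"
    proof (rule ccontr)
      assume "\<not> thesis"
      then have b: "\<beta> j = 0" for j using that by blast
      have "\<alpha> i = 0" for i
      proof -
        have "(\<Sum>k\<in>UNIV. (\<alpha> k * dot (c i) (p k)) *s p k) = (\<alpha> i * D) *s p i"
          by (simp add: cp if_distrib[of "\<lambda>x. _ * x"] if_distrib[of "\<lambda>x. x *s _"] cong: if_cong)
        then have "(\<alpha> i * D) *s p i = 0" using dep[of "c i"] by (simp add: b)
        then have "\<alpha> i * D * dot (c i) (p i) = 0" by (simp only: dot_linear flip: dot_linear(3))
        then show ?thesis using D by (simp add: cp D_def)
      qed
      then show False using ab b by blast
    qed
    have "\<exists>i. dot (c i) (q j) \<noteq> 0"
    proof (rule ccontr)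
      assume "\<not> ?thesis"
      then have "D *s q j = 0" using expand[of "q j"] by simp
      then show False using D q by (simp add: D_def)
    qed
    then show ?thesis using j by (auto simp: \<omega>_def)
  qed
  ultimately show ?thesis unfolding equilibrium_stress_def by blast
qed

lemma bracket_0_dependent:
  assumes "bracket (p 1) (p 2) (p 3) = 0"
  shows "\<exists>\<mu>. (\<exists>i. \<mu> i \<noteq> 0) \<and> (\<Sum>i\<in>(UNIV :: 3 set). \<mu> i *s p i) = 0"
proof -
  have "\<exists>x y z. (x, y, z) \<noteq> (0, 0, 0) \<and> x *s p 1 + y *s p 2 + z *s p 3 = 0"
  proof (cases "cross (p 1) (p 2) = 0")
    case False
    obtain w where w: "bracket (p 1) (p 2) w \<noteq> 0" using dot_nondegenerate[OF False] by (auto simp: bracket_def)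
    have "bracket (p 1) (p 2) w *s p 3 = bracket (p 3) (p 2) w *s p 1 + bracket (p 1) (p 3) w *s p 2"
      using bracket_expand[of "p 1" "p 2" w "p 3"] assms by simp
    then show ?thesis using w
      by (intro exI[of _ "- bracket (p 3) (p 2) w"] exI[of _ "- bracket (p 1) (p 3) w"] exI[of _ "bracket (p 1) (p 2) w"])
         (simp add: vec3_eq_iff)
  next
    case True
    show ?thesis
    proof (cases "p 1 = 0")
      case True then show ?thesis by (intro exI[of _ 1] exI[of _ 0]) simp
    next
      case False
      then obtain c where "p 2 = c *s p 1" using True cross_eq_0_iff by blast
      then show ?thesis by (intro exI[of _ "-c"] exI[of _ 1] exI[of _ 0]) (simp add: vec3_eq_iff)
    qed
  qed
  then obtain x y z where xyz: "(x, y, z) \<noteq> (0, 0, 0)" "x *s p 1 + y *s p 2 + z *s p 3 = 0" by blast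
  define \<mu> where "\<mu> i = (if i = 1 then x else if i = 2 then y else z)" for i :: 3
  have "\<mu> 1 = x" "\<mu> 2 = y" "\<mu> 3 = z" by (simp_all add: \<mu>_def)
  then show ?thesis using xyz by (intro exI[of _ \<mu>]) (auto simp: sum_3)
qed

text \<open>
  By symmetry, a triple of either parity that is not collinear serves as the basis in the previous
  construction. If both are collinear, the product of their linear dependencies is a stress.
\<close>

theorem stress_if_on_conic:
  assumes g: "form 2 g" "g v \<noteq> 0" and z: "\<And>i. g (p i) = 0" "\<And>j. g (q j) = 0"
    and nz: "\<And>i. p i \<noteq> 0" "\<And>j. q j \<noteq> 0"
  shows "\<exists>\<omega>. equilibrium_stress p q \<omega> \<and> (\<exists>i j. \<omega> i j \<noteq> 0)"
proof -
  obtain \<eta> where l: "\<exists>k. \<eta> k \<noteq> 0" "\<And>n. (\<Sum>k\<in>UNIV. (\<eta> k * dot n (case_sum p q k)) *s case_sum p q k) = 0"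
    by (rule conic_dependency[OF g, of "case_sum p q"]) (auto simp: z split: sum.split)
  define \<alpha> \<beta> where "\<alpha> i = \<eta> (Inl i)" and "\<beta> j = \<eta> (Inr j)" for i j
  have dep: "(\<Sum>i\<in>UNIV. (\<alpha> i * dot n (p i)) *s p i) + (\<Sum>j\<in>UNIV. (\<beta> j * dot n (q j)) *s q j) = 0" for n
    using l(2)[of n] by (simp add: sum_UNIV_plus \<alpha>_def \<beta>_def)
  have ab: "(\<exists>i. \<alpha> i \<noteq> 0) \<or> (\<exists>j. \<beta> j \<noteq> 0)"
    using l(1) unfolding \<alpha>_def \<beta>_def by (metis sum.exhaust)
  consider "bracket (p 1) (p 2) (p 3) \<noteq> 0" | "bracket (q 1) (q 2) (q 3) \<noteq> 0"
    | "bracket (p 1) (p 2) (p 3) = 0" "bracket (q 1) (q 2) (q 3) = 0" by blast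
  then show ?thesis
  proof cases
    case 1 then show ?thesis using stress_if_independent nz(2) ab dep by blast
  next
    case 2
    have "\<exists>\<omega>. equilibrium_stress q p \<omega> \<and> (\<exists>i j. \<omega> i j \<noteq> 0)"
      by (rule stress_if_independent[of q p \<beta> \<alpha>]) (use 2 nz ab dep in \<open>auto simp: add.commute\<close>)
    then obtain \<omega> i j where \<omega>: "equilibrium_stress q p \<omega>" "\<omega> i j \<noteq> 0" by blast
    then have "equilibrium_stress p q (\<lambda>i j. \<omega> j i)"
      unfolding equilibrium_stress_def cross_skew[of "p _"] by (auto simp: sum_negf)
    then show ?thesis using \<omega>(2) by blast
  next
    case 3
    obtain \<mu> i where m: "\<mu> i \<noteq> 0" "(\<Sum>i\<in>UNIV. \<mu> i *s p i) = 0" using bracket_0_dependent[OF 3(1)] by blast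
    obtain \<nu> j where n: "\<nu> j \<noteq> 0" "(\<Sum>j\<in>UNIV. \<nu> j *s q j) = 0" using bracket_0_dependent[OF 3(2)] by blast
    have "(\<Sum>j\<in>UNIV. (\<mu> i * \<nu> j) *s cross (p i) (q j)) = \<mu> i *s cross (p i) (\<Sum>j\<in>UNIV. \<nu> j *s q j)" for i
      by (simp add: cross_sum cross_linear vec.scale_sum_right)
    moreover have "(\<Sum>i\<in>UNIV. (\<mu> i * \<nu> j) *s cross (p i) (q j)) = \<nu> j *s cross (\<Sum>i\<in>UNIV. \<mu> i *s p i) (q j)" for j
      by (simp add: cross_sum cross_linear vec.scale_sum_right mult.commute)
    ultimately have "equilibrium_stress p q (\<lambda>i j. \<mu> i * \<nu> j)"
      using m n unfolding equilibrium_stress_def by (auto simp: cross_linear)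
    moreover have "\<mu> i * \<nu> j \<noteq> 0" using m(1) n(1) by simp
    ultimately show ?thesis by blast
  qed
qed

section \<open>A stress prevents 2-formality\<close>

context k33_arrangement
begin

text \<open>
  No two of the lines through \<open>p i\<close> coincide, so a relation between two of them is trivial. Evaluating
  at the third \<open>q k\<close> isolates one coefficient.
\<close>

lemma row_relation_zero:
  assumes "(\<Sum>j\<in>UNIV. y j *s side (i, j)) = 0" "y j' = 0"
  shows "y j = 0"
proof (cases "j = j'")
  case False
  then obtain k where k: "k \<noteq> j" "k \<noteq> j'" "UNIV = {j, j', k}" using exhaust_distinct_3 by metis
  have "(\<Sum>j\<in>UNIV. y j * dot (side (i, j)) (q k)) = 0"
    using arg_cong[OF assms(1), of "\<lambda>x. dot x (q k)"] by (simp add: dot_sum dot_linear)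
  then have "y j * dot (side (i, j)) (q k) = 0"
    unfolding k(3) using False k(1,2) assms(2) by (simp add: vertex_on_side)
  then show ?thesis using k by (simp add: side_through_q_iff)
qed (use assms in simp)

lemma column_relation_zero:
  assumes "(\<Sum>i\<in>UNIV. y i *s side (i, j)) = 0" "y i' = 0"
  shows "y i = 0"
proof (cases "i = i'")
  case False
  then obtain k where k: "k \<noteq> i" "k \<noteq> i'" "UNIV = {i, i', k}" using exhaust_distinct_3 by metis
  have "(\<Sum>i\<in>UNIV. y i * dot (side (i, j)) (p k)) = 0"
    using arg_cong[OF assms(1), of "\<lambda>x. dot x (p k)"] by (simp add: dot_sum dot_linear)
  then have "y i * dot (side (i, j)) (p k) = 0"
    unfolding k(3) using False k(1,2) assms(2) by (simp add: vertex_on_side)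
  then show ?thesis using k by (simp add: side_through_p_iff)
qed (use assms in simp)

text \<open>
  The nonvanishing spreads along the edges of the connected graph.
\<close>

lemma stress_nonzero:
  assumes "stress \<omega>" "\<omega> i j \<noteq> 0"
  shows "\<omega> i' j' \<noteq> 0"
proof -
  have "\<omega> i j' \<noteq> 0" using row_relation_zero[of "\<omega> i" i j' j] assms by (auto simp: stress_iff)
  then show ?thesis using column_relation_zero[of "\<lambda>i. \<omega> i j'" j' i' i] assms(1) by (auto simp: stress_iff)
qed

lemma sum_product_UNIV: "(\<Sum>e\<in>(UNIV :: ('a::finite \<times> 'b::finite) set). f e) = (\<Sum>a\<in>UNIV. \<Sum>b\<in>UNIV. f (a, b))"
  by (simp add: sum.cartesian_product)

text \<open>
  A relation between three lines makes them concurrent, so they share a vertex.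
\<close>

lemma three_term_relation:
  assumes c: "card {e. c e \<noteq> 0} = 3" and rel: "(\<Sum>e\<in>UNIV. c e *s side e) = 0"
  shows "(\<exists>i. \<forall>e. fst e \<noteq> i \<longrightarrow> c e = 0) \<or> (\<exists>j. \<forall>e. snd e \<noteq> j \<longrightarrow> c e = 0)"
proof -
  obtain e1 e2 e3 where e: "{e. c e \<noteq> 0} = {e1, e2, e3}" "e1 \<noteq> e2" "e1 \<noteq> e3" "e2 \<noteq> e3"
    using c by (auto simp: card_3_iff)
  have "(\<Sum>e\<in>UNIV. c e *s side e) = (\<Sum>e\<in>{e1, e2, e3}. c e *s side e)"
    by (rule sum.mono_neutral_right) (use e(1) in auto)
  then have r: "c e1 *s side e1 + c e2 *s side e2 + c e3 *s side e3 = 0"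
    using rel e by (simp add: add.assoc)
  have "bracket (side e1) (side e2) (c e1 *s side e1 + c e2 *s side e2 + c e3 *s side e3) = c e3 * bracket (side e1) (side e2) (side e3)"
    by (simp add: bracket_def dot_linear)
  then have "bracket (side e1) (side e2) (side e3) = 0"
    using r e(1) by (auto simp: bracket_def dot_linear)
  then have "fst e1 = fst e2 \<and> fst e2 = fst e3 \<or> snd e1 = snd e2 \<and> snd e2 = snd e3"
    using concurrent_imp_vertex[of "fst e1" "snd e1" "fst e2" "snd e2" "fst e3" "snd e3"] e(2-4)
    by (simp add: side_def)
  moreover have "c e = 0 \<or> e = e1 \<or> e = e2 \<or> e = e3" for e using e(1) by auto
  ultimately show ?thesis by metis
qed

lemma three_sides_independent: "bracket (side (1, 1)) (side (1, 2)) (side (2, 1)) \<noteq> 0"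
  using concurrent_imp_vertex[of 1 1 1 2 2 1] by (auto simp: side_def)

text \<open>
  The relations of weight three lie in the span of the six vertex relations \<open>R i\<close> and \<open>C j\<close>, of which
  \<open>C 3\<close> is redundant. If the arrangement were 2-formal, the five remaining ones together with
  coordinate vectors of three independent lines would span the space of all coefficient vectors, whose
  dimension is nine.
\<close>

theorem not_two_formal_of_stress:
  fixes m :: "'d::finite \<Rightarrow> poly3" and \<phi> :: "3 \<times> 3 \<Rightarrow> 'd"
  assumes \<omega>: "stress \<omega>" "\<omega> i0 j0 \<noteq> 0"
    and \<phi>: "bij \<phi>" and \<kappa>: "\<And>e. \<kappa> e \<noteq> 0"
    and m: "\<And>e v. eval3 (m (\<phi> e)) v = \<kappa> e * dot (side e) v"
  shows "\<not> two_formal m"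
proof
  assume tf: "two_formal m"
  have nz: "\<omega> i j \<noteq> 0" for i j using stress_nonzero \<omega> by blast
  have reindex: "(\<Sum>d\<in>UNIV. f d) = (\<Sum>e\<in>UNIV. f (\<phi> e))" for f :: "'d \<Rightarrow> 'x::comm_monoid_add"
    using sum.reindex_bij_betw[OF \<phi>, of f] by simp
  have rel: "c \<in> relation_space m \<longleftrightarrow> (\<Sum>e\<in>UNIV. (c $ \<phi> e * \<kappa> e) *s side e) = 0" for c
  proof -
    have ev: "eval3 (\<Sum>d\<in>UNIV. const3 (c $ d) * m d) v = dot (\<Sum>e\<in>UNIV. (c $ \<phi> e * \<kappa> e) *s side e) v" for v
      by (simp add: eval3_sum reindex m dot_sum dot_linear mult.assoc)
    have eq0: "p = 0 \<longleftrightarrow> (\<forall>v. eval3 p v = 0)" for p using eval3_eq_0_imp[of p] by auto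
    have "c \<in> relation_space m \<longleftrightarrow> (\<forall>v. dot (\<Sum>e\<in>UNIV. (c $ \<phi> e * \<kappa> e) *s side e) v = 0)"
      unfolding relation_space_def mem_Collect_eq eq0 ev ..
    also have "\<dots> \<longleftrightarrow> (\<Sum>e\<in>UNIV. (c $ \<phi> e * \<kappa> e) *s side e) = 0"
      using dot_nondegenerate by (auto simp: dot_linear)
    finally show ?thesis .
  qed
  define lift :: "(3 \<times> 3 \<Rightarrow> complex) \<Rightarrow> complex^'d" where "lift y = (\<chi> d. y (inv \<phi> d) / \<kappa> (inv \<phi> d))" for y
  have inv: "inv \<phi> (\<phi> e) = e" "\<phi> (inv \<phi> d) = d" for e d
    using \<phi> by (simp_all add: bij_is_inj bij_is_surj surj_f_inv_f)
  have lift_nth: "lift y $ \<phi> e * \<kappa> e = y e" for y e using \<kappa> by (simp add: lift_def inv)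
  have lift_eqI: "c = lift y" if "\<And>e. c $ \<phi> e * \<kappa> e = y e" for c y
  proof -
    have "c $ d = lift y $ d" for d using that[of "inv \<phi> d"] \<kappa> by (simp add: lift_def inv field_simps)
    then show ?thesis by (simp add: vec_eq_iff)
  qed
  define R where "R i = lift (\<lambda>e. if fst e = i then \<omega> i (snd e) else 0)" for i
  define C where "C j = lift (\<lambda>e. if snd e = j then \<omega> (fst e) j else 0)" for j
  define B where "B = {R 1, R 2, R 3, C 1, C 2}"
  have C3: "C 3 = R 1 + R 2 + R 3 - C 1 - C 2"
  proof -
    \<comment> \<open>every edge has one odd and one even end, so both sides count it once\<close>
    have "R 1 + R 2 + R 3 = C 1 + C 2 + C 3"
      unfolding vec_eq_iff
    proof
      fix d
      obtain i j where "inv \<phi> d = (i, j)" by force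
      then show "(R 1 + R 2 + R 3) $ d = (C 1 + C 2 + C 3) $ d"
        using exhaust_3[of i] exhaust_3[of j] by (elim disjE) (simp_all add: R_def C_def lift_def)
    qed
    then show ?thesis by (simp add: algebra_simps)
  qed
  have RB: "R i \<in> vec.span B" for i
    using exhaust_3[of i] by (auto simp: B_def intro: vec.span_base)
  have "C 3 \<in> vec.span B" unfolding C3
    by (intro vec.span_diff vec.span_add) (auto simp: B_def intro: vec.span_base)
  then have CB: "C j \<in> vec.span B" for j
    using exhaust_3[of j] by (auto simp: B_def intro: vec.span_base)
  have short: "c \<in> vec.span B" if c: "c \<in> relation_space m" "card {d. c $ d \<noteq> 0} = 3" for c
  proof -
    define y where "y e = c $ \<phi> e * \<kappa> e" for e
    have y: "(\<Sum>e\<in>UNIV. y e *s side e) = 0" using c(1) rel y_def by simp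
    have "{d. c $ d \<noteq> 0} = \<phi> ` {e. y e \<noteq> 0}"
      using \<kappa> inv(2) by (auto simp: y_def image_iff simp del: split_paired_Ex) metis
    then have "card {e. y e \<noteq> 0} = 3"
      using c(2) card_image[of \<phi> "{e. y e \<noteq> 0}"] \<phi> by (metis bij_is_inj inj_on_subset subset_UNIV)
    from three_term_relation[OF this y] show ?thesis
    proof (elim disjE exE)
      fix i assume z: "\<forall>e. fst e \<noteq> i \<longrightarrow> y e = 0"
      define t where "t = y (i, 1) / \<omega> i 1"
      have "(\<Sum>e\<in>UNIV. y e *s side e) = (\<Sum>a\<in>UNIV. if a = i then (\<Sum>b\<in>UNIV. y (i, b) *s side (i, b)) else 0)"
        unfolding sum_product_UNIV by (intro sum.cong) (auto simp: z)
      then have "(\<Sum>b\<in>UNIV. y (i, b) *s side (i, b)) = 0" using y by simp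
      moreover have "(\<Sum>b\<in>UNIV. \<omega> i b *s side (i, b)) = 0" using \<omega> by (simp add: stress_iff)
      moreover have "(\<Sum>b\<in>UNIV. (y (i, b) - t * \<omega> i b) *s side (i, b)) =
          (\<Sum>b\<in>UNIV. y (i, b) *s side (i, b)) - t *s (\<Sum>b\<in>UNIV. \<omega> i b *s side (i, b))"
        by (simp add: vec.scale_left_diff_distrib sum_subtractf vec.scale_sum_right)
      ultimately have "(\<Sum>b\<in>UNIV. (y (i, b) - t * \<omega> i b) *s side (i, b)) = 0" by simp
      then have "y (i, b) - t * \<omega> i b = 0" for b
        by (rule row_relation_zero[where j' = 1]) (use nz in \<open>simp add: t_def\<close>)
      then have "y e = (if fst e = i then t * \<omega> i (snd e) else 0)" for e using z by (cases e) auto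
      then have "c = lift (\<lambda>e. if fst e = i then t * \<omega> i (snd e) else 0)" by (intro lift_eqI) (simp add: y_def)
      also have "\<dots> = t *s R i" by (simp add: R_def lift_def vec_eq_iff)
      finally show ?thesis using RB by (simp add: vec.span_scale)
    next
      fix j assume z: "\<forall>e. snd e \<noteq> j \<longrightarrow> y e = 0"
      define t where "t = y (1, j) / \<omega> 1 j"
      have "(\<Sum>e\<in>UNIV. y e *s side e) = (\<Sum>a\<in>UNIV. \<Sum>b\<in>UNIV. if b = j then y (a, j) *s side (a, j) else 0)"
        unfolding sum_product_UNIV by (intro sum.cong) (auto simp: z)
      then have "(\<Sum>a\<in>UNIV. y (a, j) *s side (a, j)) = 0" using y by simp
      moreover have "(\<Sum>a\<in>UNIV. \<omega> a j *s side (a, j)) = 0" using \<omega> by (simp add: stress_iff)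
      moreover have "(\<Sum>a\<in>UNIV. (y (a, j) - t * \<omega> a j) *s side (a, j)) =
          (\<Sum>a\<in>UNIV. y (a, j) *s side (a, j)) - t *s (\<Sum>a\<in>UNIV. \<omega> a j *s side (a, j))"
        by (simp add: vec.scale_left_diff_distrib sum_subtractf vec.scale_sum_right)
      ultimately have "(\<Sum>a\<in>UNIV. (y (a, j) - t * \<omega> a j) *s side (a, j)) = 0" by simp
      then have "y (a, j) - t * \<omega> a j = 0" for a
        by (rule column_relation_zero[where i' = 1]) (use nz in \<open>simp add: t_def\<close>)
      then have "y e = (if snd e = j then t * \<omega> (fst e) j else 0)" for e using z by (cases e) auto
      then have "c = lift (\<lambda>e. if snd e = j then t * \<omega> (fst e) j else 0)" by (intro lift_eqI) (simp add: y_def)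
      also have "\<dots> = t *s C j" by (simp add: C_def lift_def vec_eq_iff)
      finally show ?thesis using CB by (simp add: vec.span_scale)
    qed
  qed
  then have "vec.span {c \<in> relation_space m. card {d. c $ d \<noteq> 0} = 3} \<subseteq> vec.span B"
    by (intro vec.span_minimal vec.subspace_span) auto
  then have F: "relation_space m \<subseteq> vec.span B" using tf by (simp add: two_formal_def)
  define u where "u e = axis (\<phi> e) (1 / \<kappa> e)" for e
  have u: "u e $ \<phi> e' * \<kappa> e' = (if e' = e then 1 else 0)" for e e'
    using \<kappa> bij_is_inj[OF \<phi>] by (simp add: u_def axis_def inj_eq)
  define B' where "B' = B \<union> {u (1, 1), u (1, 2), u (2, 1)}"
  have "c \<in> vec.span B'" for c
  proof -
    define s where "s = (\<Sum>e\<in>UNIV. (c $ \<phi> e * \<kappa> e) *s side e)"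
    define D where "D = bracket (side (1, 1)) (side (1, 2)) (side (2, 1))"
    have D: "D \<noteq> 0" using three_sides_independent by (simp add: D_def)
    obtain x y z where s: "s = x *s side (1, 1) + y *s side (1, 2) + z *s side (2, 1)"
    proof -
      have "s = (1 / D) *s (D *s s)" using D by simp
      then show ?thesis using that
        unfolding D_def bracket_expand[of "side (1, 1)" "side (1, 2)" "side (2, 1)" s]
        by (simp only: vec.scale_right_distrib vec.scale_scale)
    qed
    define c' where "c' = x *s u (1, 1) + y *s u (1, 2) + z *s u (2, 1)"
    have "(\<Sum>e\<in>UNIV. (c' $ \<phi> e * \<kappa> e) *s side e) =
      x *s (\<Sum>e\<in>UNIV. (u (1, 1) $ \<phi> e * \<kappa> e) *s side e) + y *s (\<Sum>e\<in>UNIV. (u (1, 2) $ \<phi> e * \<kappa> e) *s side e)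
      + z *s (\<Sum>e\<in>UNIV. (u (2, 1) $ \<phi> e * \<kappa> e) *s side e)"
      unfolding vec.scale_sum_right sum.distrib[symmetric]
      by (rule sum.cong) (simp_all add: c'_def vec.scale_left_distrib distrib_right mult.assoc)
    also have "\<dots> = s" unfolding u s by (simp add: if_distrib[of "\<lambda>x. x *s _"] cong: if_cong)
    finally have "c - c' \<in> relation_space m"
      unfolding rel s_def by (simp add: left_diff_distrib vec.scale_left_diff_distrib sum_subtractf)
    then have "c - c' \<in> vec.span B'" using F vec.span_mono[of B B'] by (auto simp: B'_def)
    moreover have "c' \<in> vec.span B'" unfolding c'_def
      by (intro vec.span_add vec.span_scale) (auto simp: B'_def intro: vec.span_base)
    ultimately show ?thesis using vec.span_add[of "c - c'" B' c'] by simp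
  qed
  then have "vec.dim (UNIV :: (complex^'d) set) \<le> card B'"
    by (intro vec.dim_le_card) (auto simp: B'_def B_def)
  moreover have "CARD('d) = 9" using bij_betw_same_card[OF \<phi>] card_sides by simp
  moreover have "card B' \<le> 8"
    using card_length[of "[R 1, R 2, R 3, C 1, C 2, u (1, 1), u (1, 2), u (2, 1)]"]
    by (simp add: B'_def B_def insert_commute Un_insert_left del: card_insert_disjoint)
  ultimately show False unfolding vec_dim_card by linarith
qed

end

section \<open>Minimal degree of a Jacobian syzygy\<close>

context k33_arrangement
begin

text \<open>
  The defining polynomial differs from the product of the linear forms \<open>side e\<close> by the nonzero
  constant \<open>\<Prod>\<kappa>\<close>, which rescales the gradient.
\<close>

lemma jacobian_syzygies_iff:
  fixes m :: "'d::finite \<Rightarrow> poly3" and \<phi> :: "3 \<times> 3 \<Rightarrow> 'd"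
  assumes \<phi>: "bij \<phi>" and \<kappa>: "\<And>e. \<kappa> e \<noteq> 0"
    and m: "\<And>e v. eval3 (m (\<phi> e)) v = \<kappa> e * dot (side e) v"
  shows "(a, b, c) \<in> jacobian_syzygies (arr_poly m) \<longleftrightarrow> (\<forall>v. dot (grad v) (vector [eval3 a v, eval3 b v, eval3 c v]) = 0)"
proof -
  define K where "K = (\<Prod>e\<in>UNIV. \<kappa> e)"
  have K: "K \<noteq> 0" using \<kappa> by (simp add: K_def)
  define n where "n d = \<kappa> (inv \<phi> d) *s side (inv \<phi> d)" for d
  have inv: "inv \<phi> (\<phi> e) = e" "\<phi> (inv \<phi> d) = d" for e d
    using \<phi> by (simp_all add: bij_is_inj bij_is_surj surj_f_inv_f)
  have n: "eval3 (m d) v = dot (n d) v" for d v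
    using m[of "inv \<phi> d" v] by (simp add: n_def inv dot_linear)
  have "eval3 (pderiv3 i (arr_poly m)) v = K * grad v $ i" for i v
  proof -
    have "(\<Sum>d\<in>UNIV. n d $ i * (\<Prod>d'\<in>UNIV - {d}. dot (n d') v))
        = (\<Sum>e\<in>UNIV. n (\<phi> e) $ i * (\<Prod>d'\<in>UNIV - {\<phi> e}. dot (n d') v))"
      using sum.reindex_bij_betw[OF \<phi>, of "\<lambda>d. n d $ i * (\<Prod>d'\<in>UNIV - {d}. dot (n d') v)"] by simp
    also have "\<dots> = (\<Sum>e\<in>UNIV. K * ((\<Prod>e'\<in>UNIV - {e}. dot (side e') v) * side e $ i))"
    proof (rule sum.cong)
      fix e
      have "bij_betw \<phi> (UNIV - {e}) (UNIV - {\<phi> e})"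
        using \<phi> by (intro bij_betw_imageI)
          (auto simp: bij_def image_set_diff intro: inj_on_subset)
      then have "(\<Prod>d'\<in>UNIV - {\<phi> e}. dot (n d') v) = (\<Prod>e'\<in>UNIV - {e}. \<kappa> e' * dot (side e') v)"
        using prod.reindex_bij_betw[of \<phi> "UNIV - {e}" "UNIV - {\<phi> e}" "\<lambda>d. dot (n d) v"] by (simp add: n_def inv dot_linear)
      moreover have "K = \<kappa> e * (\<Prod>e'\<in>UNIV - {e}. \<kappa> e')"
        unfolding K_def by (rule prod.remove) auto
      ultimately show "n (\<phi> e) $ i * (\<Prod>d'\<in>UNIV - {\<phi> e}. dot (n d') v) = K * ((\<Prod>e'\<in>UNIV - {e}. dot (side e') v) * side e $ i)"
        by (simp add: n_def inv prod.distrib)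
    qed simp
    also have "\<dots> = K * grad v $ i" by (simp add: grad_def sum_distrib_left)
    finally show ?thesis by (simp add: pderiv3_prod_linear[OF n])
  qed
  note pd = this
  have ev: "eval3 (a * pderiv3 1 (arr_poly m) + b * pderiv3 2 (arr_poly m) + c * pderiv3 3 (arr_poly m)) v
     = K * dot (grad v) (vector [eval3 a v, eval3 b v, eval3 c v])" for v
    by (simp add: pd dot_def algebra_simps)
  have eq0: "x = 0 \<longleftrightarrow> (\<forall>v. eval3 x v = 0)" for x using eval3_eq_0_imp[of x] by auto
  show ?thesis unfolding jacobian_syzygies_def by (simp only: mem_Collect_eq prod.case eq0 ev) (simp add: K)
qed

theorem mdr_of_stress:
  fixes m :: "'d::finite \<Rightarrow> poly3" and \<phi> :: "3 \<times> 3 \<Rightarrow> 'd"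
  assumes \<omega>: "stress \<omega>" "\<omega> i0 j0 \<noteq> 0"
    and m: "bij \<phi>" "\<And>e. \<kappa> e \<noteq> 0" "\<And>e v. eval3 (m (\<phi> e)) v = \<kappa> e * dot (side e) v"
  shows "mdr (arr_poly m) = 5"
  unfolding mdr_def
proof (rule Least_equality)
  obtain \<delta> where \<delta>: "\<And>i. form 5 (\<lambda>v. \<delta> v $ i)" "\<exists>v. \<delta> v \<noteq> 0" "\<And>v. dot (grad v) (\<delta> v) = 0"
    using syzygy_of_stress[OF \<omega>] by blast
  have "\<exists>a\<in>homogeneous 5. \<forall>v. eval3 a v = \<delta> v $ i" for i
    using form_imp_homogeneous[OF \<delta>(1)[of i]] by (auto simp: fun_eq_iff)
  then obtain a where a: "\<And>i. a i \<in> homogeneous 5" "\<And>i v. eval3 (a i) v = \<delta> v $ i" by metis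
  have vec: "vector [eval3 (a 1) v, eval3 (a 2) v, eval3 (a 3) v] = \<delta> v" for v
    by (simp add: a(2) vec3_eq_iff)
  have "(a 1, a 2, a 3) \<in> jacobian_syzygies (arr_poly m)"
    unfolding jacobian_syzygies_iff[OF m] vec using \<delta>(3) by blast
  moreover have "(a 1, a 2, a 3) \<noteq> (0, 0, 0)"
  proof
    assume 0: "(a 1, a 2, a 3) = (0, 0, 0)"
    then have "\<delta> v = 0" for v using vec[of v] by (simp add: vec3_eq_iff)
    then show False using \<delta>(2) by blast
  qed
  ultimately show "\<exists>a\<in>homogeneous 5. \<exists>b\<in>homogeneous 5. \<exists>c\<in>homogeneous 5. (a, b, c) \<noteq> (0, 0, 0) \<and> (a, b, c) \<in> jacobian_syzygies (arr_poly m)"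
    using a(1) by blast
next
  fix k assume "\<exists>a\<in>homogeneous k. \<exists>b\<in>homogeneous k. \<exists>c\<in>homogeneous k. (a, b, c) \<noteq> (0, 0, 0) \<and> (a, b, c) \<in> jacobian_syzygies (arr_poly m)"
  then obtain a b c where abc: "a \<in> homogeneous k" "b \<in> homogeneous k" "c \<in> homogeneous k" "(a, b, c) \<noteq> (0, 0, 0)"
    "(a, b, c) \<in> jacobian_syzygies (arr_poly m)" by blast
  define \<delta> :: "complex^3 \<Rightarrow> complex^3" where "\<delta> v = vector [eval3 a v, eval3 b v, eval3 c v]" for v
  have form: "form k (\<lambda>v. \<delta> v $ i)" for i
    using exhaust_3[of i] form_eval3[OF abc(1)] form_eval3[OF abc(2)] form_eval3[OF abc(3)] by (auto simp: \<delta>_def)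
  have syz: "dot (grad v) (\<delta> v) = 0" for v using abc(5) unfolding jacobian_syzygies_iff[OF m] \<delta>_def by blast
  show "5 \<le> k"
  proof (rule ccontr)
    assume "\<not> 5 \<le> k"
    then have "\<delta> v = 0" for v using no_syzygy_below_5[OF form _ syz] by simp
    then have "a = 0" "b = 0" "c = 0"
      by (intro eval3_eq_0_imp; simp add: \<delta>_def vec3_eq_iff)+
    then show False using abc(4) by simp
  qed
qed

end

section \<open>Hexagons\<close>

lemma in_span_singleton: "w \<in> vec.span {v} \<longleftrightarrow> (\<exists>c. w = c *s v)" for v w :: "complex^3"
  by (auto simp: vec.span_singleton)

lemma span_in_zero_locus:
  assumes "v \<noteq> 0" "\<And>v. eval3 l v = dot n v"
  shows "vec.span {v} \<in> zero_locus l \<longleftrightarrow> dot n v = 0"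
proof -
  have "v \<in> vec.span {v}" by (simp add: vec.span_base)
  then show ?thesis using assms
    by (auto simp: zero_locus_def proj_plane_def in_span_singleton dot_linear)
qed

lemma parallel_zero_locus:
  assumes "\<And>v. eval3 l v = dot n v" "\<And>v. eval3 l' v = dot n' v" "n \<noteq> 0" "n' \<noteq> 0" "cross n n' = 0"
  shows "zero_locus l = zero_locus l'"
proof -
  obtain c where "n' = c *s n" using cross_eq_0_iff assms(3,5) by blast
  then have "dot n' v = 0 \<longleftrightarrow> dot n v = 0" for v using assms(4) by (auto simp: dot_linear)
  then show ?thesis by (simp add: zero_locus_def assms(1,2))
qed

lemma exhaust_6: "k \<in> {1, 2, 3, 4, 5, 6}" for k :: 6
proof -
  have "card {1, 2, 3, 4, 5, 6 :: 6} = CARD(6)" by simp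
  then have "{1, 2, 3, 4, 5, 6 :: 6} = UNIV" by (intro card_subset_eq) auto
  then show ?thesis by blast
qed

definition odd_vertex :: "3 \<Rightarrow> 6" where
  "odd_vertex i = (if i = 1 then 1 else if i = 2 then 3 else 5)"

definition even_vertex :: "3 \<Rightarrow> 6" where
  "even_vertex j = (if j = 1 then 2 else if j = 2 then 4 else 6)"

text \<open>
  The line joining the \<open>i\<close>-th odd to the \<open>j\<close>-th even vertex, where the odd vertices are numbered
  \<open>A\<^sub>1, A\<^sub>3, A\<^sub>5\<close> and the even ones \<open>A\<^sub>2, A\<^sub>4, A\<^sub>6\<close>.
\<close>

definition hexagon_line :: "3 \<times> 3 \<Rightarrow> 6 + 3" where
  "hexagon_line = (\<lambda>(i, j).
     if i = 1 then (if j = 1 then Inl 1 else if j = 2 then Inr 1 else Inl 6)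
     else if i = 2 then (if j = 1 then Inl 2 else if j = 2 then Inl 3 else Inr 3)
     else (if j = 1 then Inr 2 else if j = 2 then Inl 4 else Inl 5))"

lemma bij_hexagon_line: "bij hexagon_line"
proof -
  have inj: "inj hexagon_line"
  proof (rule injI)
    fix d e assume eq: "hexagon_line d = hexagon_line e"
    obtain i j i' j' where [simp]: "d = (i, j)" "e = (i', j')" by force
    show "d = e"
      using eq exhaust_3[of i] exhaust_3[of j] exhaust_3[of i'] exhaust_3[of j']
      by (elim disjE) (simp_all add: hexagon_line_def)
  qed
  have "card (range hexagon_line) = 9"
    using card_image[OF inj] by (simp add: card_cartesian_product flip: UNIV_Times_UNIV)
  then have "range hexagon_line = UNIV" by (intro card_subset_eq) auto
  then show ?thesis using inj by (simp add: bij_def)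
qed

lemma hexagon_line_equation:
  assumes "hexagonal_arrangement A m"
  shows "line_equation (m (hexagon_line (i, j))) (A (odd_vertex i)) (A (even_vertex j))"
proof -
  have sym: "line_equation l P Q \<Longrightarrow> line_equation l Q P" for l P Q by (auto simp: line_equation_def)
  have *: "line_equation (m (Inl j)) (A j) (A (j + 1))" for j
    using assms by (simp add: hexagonal_arrangement_def)
  have seven: "(7 :: 6) = 1" by simp
  have sides: "line_equation (m (Inl 1)) (A 1) (A 2)" "line_equation (m (Inl 2)) (A 2) (A 3)"
    "line_equation (m (Inl 3)) (A 3) (A 4)" "line_equation (m (Inl 4)) (A 4) (A 5)"
    "line_equation (m (Inl 5)) (A 5) (A 6)" "line_equation (m (Inl 6)) (A 6) (A 1)"
    using *[of 1] *[of 2] *[of 3] *[of 4] *[of 5] *[of 6] by (simp_all add: seven)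
  have diags: "line_equation (m (Inr 1)) (A 1) (A 4)" "line_equation (m (Inr 2)) (A 2) (A 5)"
    "line_equation (m (Inr 3)) (A 3) (A 6)"
    using assms by (simp_all add: hexagonal_arrangement_def)
  show ?thesis
    using exhaust_3[of i] exhaust_3[of j] sides sides[THEN sym] diags diags[THEN sym]
    by (elim disjE) (simp_all add: hexagon_line_def odd_vertex_def even_vertex_def)
qed

theorem corollary1p7:
  fixes A :: "6 \<Rightarrow> ppoint"
    and m :: "6 + 3 \<Rightarrow> poly3"
    and q :: poly3
  assumes vertices: "\<forall>j. A j \<in> proj_plane" "inj A"
    and hexagon: "hexagonal_arrangement A m"
    and conic: "smooth_conic q \<or> two_lines_conic q"
    and on_conic: "\<forall>j. A j \<in> zero_locus q"
    and nine_lines: "card (arr_lines m) = 9"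
    and triple_points: "{P \<in> proj_plane. point_mult m P = 3} = {A j | j. True}"
    and other_points: "\<forall>P \<in> proj_plane. point_mult m P \<ge> 2 \<longrightarrow> point_mult m P = 2 \<or> point_mult m P = 3"
  shows "mdr (arr_poly m) = 5 \<and> \<not> two_formal m"
proof -
  have "\<exists>v. A k = vec.span {v} \<and> v \<noteq> 0" for k using vertices(1) by (auto simp: proj_plane_def)
  then obtain a where a: "\<And>k. A k = vec.span {a k}" "\<And>k. a k \<noteq> 0" by metis
  define P Q where "P i = a (odd_vertex i)" and "Q j = a (even_vertex j)" for i j :: 3
  let ?\<phi> = hexagon_line
  note inv = surj_f_inv_f[OF bij_is_surj[OF bij_hexagon_line]]
  have line: "m d \<in> homogeneous 1 \<and> m d \<noteq> 0" for d
    using hexagon_line_equation[OF hexagon, of "fst (inv ?\<phi> d)" "snd (inv ?\<phi> d)"]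
    by (simp add: inv line_equation_def)
  have "\<exists>n. (\<forall>v. eval3 (m d) v = dot n v) \<and> n \<noteq> 0" for d
    using linear_form_coefficients[of "m d"] line by metis
  then obtain n where n: "\<And>d v. eval3 (m d) v = dot (n d) v" "\<And>d. n d \<noteq> 0" by metis
  have inc: "dot (n (?\<phi> (i, j))) (P i) = 0" "dot (n (?\<phi> (i, j))) (Q j) = 0" "cross (P i) (Q j) \<noteq> 0" for i j
  proof -
    have l: "A (odd_vertex i) \<in> zero_locus (m (?\<phi> (i, j)))" "A (even_vertex j) \<in> zero_locus (m (?\<phi> (i, j)))"
      "A (odd_vertex i) \<noteq> A (even_vertex j)"
      using hexagon_line_equation[OF hexagon, of i j] by (auto simp: line_equation_def)
    show "dot (n (?\<phi> (i, j))) (P i) = 0" "dot (n (?\<phi> (i, j))) (Q j) = 0"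
      using l(1,2) unfolding a(1) span_in_zero_locus[OF a(2) n(1)] P_def Q_def .
    show "cross (P i) (Q j) \<noteq> 0"
    proof
      assume "cross (P i) (Q j) = 0"
      then obtain c where c: "Q j = c *s P i" using cross_eq_0_iff a(2) P_def by metis
      then have "c \<noteq> 0" using a(2)[of "even_vertex j"] by (auto simp: Q_def)
      have "w \<in> vec.span {Q j} \<longleftrightarrow> w \<in> vec.span {P i}" for w
      proof -
        have "w = d *s P i \<longleftrightarrow> w = (d / c) *s Q j" for d using \<open>c \<noteq> 0\<close> by (simp add: c)
        moreover have "w = d *s Q j \<longleftrightarrow> w = (d * c) *s P i" for d by (simp add: c)
        ultimately show ?thesis unfolding in_span_singleton by blast
      qed
      then have "vec.span {Q j} = vec.span {P i}" by blast
      then show False using l(3) by (simp add: a(1) P_def Q_def)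
    qed
  qed
  have "\<exists>c. c \<noteq> 0 \<and> n (?\<phi> e) = c *s cross (P (fst e)) (Q (snd e))" for e
  proof -
    obtain i j where e: "e = (i, j)" by force
    have "cross (n (?\<phi> e)) (cross (P i) (Q j)) = 0" using inc by (simp add: triple_cross e)
    then have "cross (cross (P i) (Q j)) (n (?\<phi> e)) = 0" using cross_skew by (metis neg_equal_0_iff_equal)
    then obtain c where "n (?\<phi> e) = c *s cross (P i) (Q j)" using cross_eq_0_iff[OF inc(3)] by blast
    then show ?thesis using n(2)[of "?\<phi> e"] e by auto
  qed
  then obtain \<kappa> where \<kappa>: "\<And>e. \<kappa> e \<noteq> 0" "\<And>e. n (?\<phi> e) = \<kappa> e *s cross (P (fst e)) (Q (snd e))" by metis
  have range: "arr_lines m = range (\<lambda>d. zero_locus (m d))" by (auto simp: arr_lines_def)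
  have inj: "inj (\<lambda>d. zero_locus (m d))"
    using nine_lines unfolding range by (intro eq_card_imp_inj_on) auto
  have distinct: "cross (n d) (n d') \<noteq> 0" if "d \<noteq> d'" for d d'
    using parallel_zero_locus[OF n(1) n(1) n(2) n(2)] inj that by (metis injD)
  interpret k33_lines P Q
  proof
    fix i j i' j' :: 3 assume "(i, j) \<noteq> (i', j')"
    then have "?\<phi> (i, j) \<noteq> ?\<phi> (i', j')" using bij_is_inj[OF bij_hexagon_line] by (metis injD)
    then show "cross (cross (P i) (Q j)) (cross (P i') (Q j')) \<noteq> 0"
      using distinct[of "?\<phi> (i, j)" "?\<phi> (i', j')"] by (auto simp: \<kappa>(2) cross_linear)
  qed
  have m: "eval3 (m (?\<phi> e)) v = \<kappa> e * dot (side e) v" for e v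
    by (simp add: n(1) \<kappa>(2) side_def dot_linear)
  have mult: "point_mult m (vec.span {v}) = card {e. dot (side e) v = 0}" if "v \<noteq> 0" for v
  proof -
    have "{L \<in> arr_lines m. vec.span {v} \<in> L} = (\<lambda>e. zero_locus (m (?\<phi> e))) ` {e. dot (side e) v = 0}"
    proof -
      have on: "vec.span {v} \<in> zero_locus (m (?\<phi> e)) \<longleftrightarrow> dot (side e) v = 0" for e
        unfolding span_in_zero_locus[OF that n(1)] using \<kappa>(1) by (simp add: \<kappa>(2) side_def dot_linear)
      have "arr_lines m = (\<lambda>e. zero_locus (m (?\<phi> e))) ` UNIV"
        unfolding range using bij_is_surj[OF bij_hexagon_line] by (metis image_image)
      then show ?thesis using on by auto
    qed
    moreover have "inj (\<lambda>e. zero_locus (m (?\<phi> e)))"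
      using inj_compose[OF inj bij_is_inj[OF bij_hexagon_line]] by (simp add: comp_def)
    ultimately show ?thesis
      by (simp add: point_mult_def card_image inj_on_subset)
  qed
  interpret k33_arrangement P Q
  proof
    fix i j i' j' i'' j'' :: 3
    assume d: "distinct [(i, j), (i', j'), (i'', j'')]"
      and "bracket (cross (P i) (Q j)) (cross (P i') (Q j')) (cross (P i'') (Q j'')) = 0"
    \<comment> \<open>the common point of the three lines has multiplicity at least 3, so it is a vertex\<close>
    define v where "v = cross (side (i, j)) (side (i', j'))"
    let ?E = "{(i, j), (i', j'), (i'', j'')}"
    have v: "v \<noteq> 0" using side_distinct d by (simp add: v_def)
    have on: "?E \<subseteq> {e. dot (side e) v = 0}"
      using \<open>bracket _ _ _ = 0\<close> by (auto simp: v_def bracket_def side_def dot_commute[of "cross _ _" "cross (cross _ _) _"])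
    have "3 \<le> point_mult m (vec.span {v})"
      using card_mono[OF _ on] d by (simp add: mult[OF v])
    moreover have pp: "vec.span {v} \<in> proj_plane" using v by (auto simp: proj_plane_def)
    ultimately have "point_mult m (vec.span {v}) = 3" using other_points by fastforce
    then obtain k where "vec.span {v} = A k" using triple_points pp by blast
    then have "a k \<in> vec.span {v}" by (simp add: a(1) vec.span_base)
    then obtain c where "a k = c *s v" using in_span_singleton by blast
    then have at: "dot (side e) (a k) = 0" if "e \<in> ?E" for e using on that by (auto simp: dot_linear)
    have "(\<exists>l. a k = P l) \<or> (\<exists>l. a k = Q l)"
    proof -
      have "P 1 = a 1" "P 2 = a 3" "P 3 = a 5" "Q 1 = a 2" "Q 2 = a 4" "Q 3 = a 6"
        by (simp_all add: P_def Q_def odd_vertex_def even_vertex_def)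
      then show ?thesis using exhaust_6[of k] by (metis empty_iff insert_iff)
    qed
    then show "i = i' \<and> i' = i'' \<or> j = j' \<and> j' = j''"
      using at[of "(i, j)"] at[of "(i', j')"] at[of "(i'', j'')"] by (auto simp: side_through_p_iff side_through_q_iff)
  qed
  have q: "q \<in> homogeneous 2" "q \<noteq> 0"
    using conic homogeneous_mult[of _ 1 _ 1]
    by (auto simp: smooth_conic_def two_lines_conic_def numeral_2_eq_2)
  obtain v where v: "eval3 q v \<noteq> 0" using eval3_eq_0_imp[of q] q(2) by blast
  have "eval3 q (a k) = 0" for k
  proof -
    have "a k \<in> A k" by (simp add: a(1) vec.span_base)
    then show ?thesis using on_conic by (auto simp: zero_locus_def)
  qed
  then obtain \<omega> i j where \<omega>: "stress \<omega>" "\<omega> i j \<noteq> 0"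
    using stress_if_on_conic[OF form_eval3[OF q(1)] v, of P Q] a(2) by (auto simp: P_def Q_def)
  show ?thesis
    using mdr_of_stress[OF \<omega> bij_hexagon_line \<kappa>(1) m] not_two_formal_of_stress[OF \<omega> bij_hexagon_line \<kappa>(1) m]
    by blast
qed

end
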